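(* Let $I:=[T_0,T]$ with $-\infty<T_0<T<+\infty$, and let $\rho\colon I\to\mathbb R$ be a nonnegative absolutely continuous function. Let $K_1,K_2,\varepsilon\colon I\to\mathbb R_+$ and $K_3\colon I\times I\to\mathbb R_+$ be nonnegative measurable functions such that $$ t\mapsto K_1(t)\quad\text{and}\quad t\mapsto K_2(t)\int_{T_0}^tK_3(t,s)\,ds $$ are integrable on $I$. Suppose that $$ \dot\rho(t)\le\varepsilon(t)+K_1(t)\rho(t)+K_2(t)\int_{T_0}^tK_3(t,s)\rho(s)\,ds\quad\text{for a.e. } t\in I. $$ Then $$ \rho(t)\le\rho(T_0)\exp\Big(\int_{T_0}^t\gamma(s)\,ds\Big)+\int_{T_0}^t\varepsilon(s)\exp\Big(\int_s^t\gamma(\tau)\,d\tau\Big)ds\quad\text{for all } t\in I, $$ where $\gamma(t):=K_1(t)+K_2(t)\int_{T_0}^tK_3(t,s)\,ds$.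
   Context: $\mathbb R_+=[0,+\infty[$. Integrals of nonnegative measurable functions are understood as Lebesgue integrals with values in $[0,+\infty]$ (in particular the right-hand side of the conclusion may be $+\infty$ when $\varepsilon$ is not integrable), with the convention $0\cdot\infty=0$. *)

theory Defs
  imports "HOL-Analysis.Analysis"
begin

(* The library constant absolutely_continuous is the relation between measures; this is the
   epsilon-delta notion for functions, with finite families of non-overlapping intervals. *)
definition absolutely_continuous_on :: "real set \<Rightarrow> (real \<Rightarrow> real) \<Rightarrow> bool" where
  "absolutely_continuous_on I f \<longleftrightarrow>
     (\<forall>e>0. \<exists>d>0. \<forall>(n::nat) a b.
        (\<forall>i<n. a i \<le> b i \<and> {a i..b i} \<subseteq> I) \<and>
        disjoint_family_on (\<lambda>i. {a i<..<b i}) {..<n} \<and>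
        (\<Sum>i<n. b i - a i) < d
        \<longrightarrow> (\<Sum>i<n. \<bar>f (b i) - f (a i)\<bar>) < e)"

(* The inner integral may be infinite on a null set of t, hence the codomain. *)
definition gronwall_gamma ::
    "real \<Rightarrow> (real \<Rightarrow> real) \<Rightarrow> (real \<Rightarrow> real) \<Rightarrow> (real \<Rightarrow> real \<Rightarrow> real) \<Rightarrow> real \<Rightarrow> ennreal" where
  "gronwall_gamma T\<^sub>0 K\<^sub>1 K\<^sub>2 K\<^sub>3 t =
     ennreal (K\<^sub>1 t) + ennreal (K\<^sub>2 t) * (\<integral>\<^sup>+s\<in>{T\<^sub>0..t}. ennreal (K\<^sub>3 t s) \<partial>lebesgue)"

(* enn2real sends infinity to 0; this is only applied to gamma as above, which has finite
   integral over every subinterval of I whenever K1 and K2 * (integral of K3) are integrable. *)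
definition exp_integral :: "(real \<Rightarrow> ennreal) \<Rightarrow> real \<Rightarrow> real \<Rightarrow> real" where
  "exp_integral g a b = exp (enn2real (\<integral>\<^sup>+\<tau>\<in>{a..b}. g \<tau> \<partial>lebesgue))"

end

theory Submission
  imports Defs
begin

text \<open>An absolutely continuous function is almost everywhere differentiable or has slopes tending to
  \<open>-\<infinity>\<close>, by Vitali's covering theorem; a further Vitali covering, fine for a gauge and combined with
  Henstock's lemma, turns the almost everywhere bound on the derivative into a bound on increments.
  For the running maximum \<open>\<theta> t = sup {\<rho> u | T\<^sub>0 \<le> u \<le> t}\<close> the memory term is dominated by
  \<open>\<theta> t\<close>, which gives \<open>\<theta> y - \<theta> x \<le> \<integral>\<^bsub>x\<^esub>\<^bsup>y\<^esup> \<epsilon> + \<theta> y * \<integral>\<^bsub>x\<^esub>\<^bsup>y\<^esup> \<gamma>\<close>. Over short intervals this multiplies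
  \<open>\<theta>\<close> by at most \<open>exp ((1 + \<delta>) * \<integral>\<gamma>)\<close>, and chaining such intervals and letting \<open>\<delta>\<close> tend to zero
  yields the claim.\<close>

subsection \<open>Absolute continuity\<close>

text \<open>\<open>deriv\<close> is unspecified where no derivative exists, so the hypothesis is
  void at such points until they are dealt with. What the increment bound needs is weak: around
  almost every \<open>x\<close>, arbitrarily short intervals of slope at most
  \<open>h x + \<eta>\<close>. This can fail only where the slopes eventually stay above that level,
  and off a null set they then converge to a finite limit, which is the derivative. Slopes tending
  to -\<infinity> satisfy the bound trivially.

  The obstacle in the Gronwall part is that the memory term sees all earlier values of \<rho>. The
  running maximum removes this dependence, but no differential inequality for it is at hand; hence
  the estimate in increments. Its coefficient is the value at the right endpoint, so with D =
  \<integral>\<gamma> a short interval gives (1 - D) * \<theta> y \<le> \<theta> x +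
  \<integral>\<epsilon>, as in an implicit Euler step. The factor 1 + \<delta> pays for the
  second-order gap between 1 / (1 - D) and exp D.\<close>

lemma absolutely_continuous_on_division:
  assumes "absolutely_continuous_on I f" and "0 < e"
  obtains d where "0 < d"
    "\<And>D. D division_of \<Union>D \<Longrightarrow> \<Union>D \<subseteq> I \<Longrightarrow> sum (measure lborel) D < d
      \<Longrightarrow> (\<Sum>K\<in>D. \<bar>f (Sup K) - f (Inf K)\<bar>) < e"
proof -
  have "\<exists>d>0. \<forall>(n::nat) a b. (\<forall>i<n. a i \<le> b i \<and> {a i..b i} \<subseteq> I) \<and>
      disjoint_family_on (\<lambda>i. {a i<..<b i}) {..<n} \<and> (\<Sum>i<n. b i - a i) < d
      \<longrightarrow> (\<Sum>i<n. \<bar>f (b i) - f (a i)\<bar>) < e"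
    using assms unfolding absolutely_continuous_on_def by (elim allE impE)
  then obtain d where d: "0 < d"
    and ac: "\<forall>(n::nat) a b. (\<forall>i<n. a i \<le> b i \<and> {a i..b i} \<subseteq> I) \<and>
      disjoint_family_on (\<lambda>i. {a i<..<b i}) {..<n} \<and> (\<Sum>i<n. b i - a i) < d
      \<longrightarrow> (\<Sum>i<n. \<bar>f (b i) - f (a i)\<bar>) < e"
    by (elim exE conjE)
  show thesis
  proof (rule that[OF d])
    fix D :: "real set set"
    assume D: "D division_of \<Union>D" and sub: "\<Union>D \<subseteq> I" and small: "sum (measure lborel) D < d"
    obtain h where h: "bij_betw h {..<card D} D"
      \<comment> \<open>An enumeration turns the division into the indexed family of the definition;
        the members are nonempty compact intervals, so \<open>Inf\<close> and \<open>Sup\<close> are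
        their endpoints and disjoint interiors mean non-overlapping.\<close>
      using ex_bij_betw_nat_finite[of D] D by (auto simp: atLeast0LessThan)
    have hD: "h i \<in> D" if "i < card D" for i
      using bij_betw_apply[OF h] that by auto
    have hI: "h i = {Inf (h i)..Sup (h i)} \<and> Inf (h i) \<le> Sup (h i)" if i: "i < card D" for i
    proof -
      obtain u v where "h i = {u..v}" "h i \<noteq> {}"
        using division_ofD(3,4)[OF D hD[OF i]] by auto
      then show ?thesis by auto
    qed
    have reindex: "sum g D = (\<Sum>i<card D. g (h i))" for g :: "real set \<Rightarrow> real"
      using sum.reindex_bij_betw[OF h, of g] by simp
    have "measure lborel (h i) = Sup (h i) - Inf (h i)" if "i < card D" for i
      using hI[OF that] by (metis measure_lborel_Icc)
    then have "(\<Sum>i<card D. Sup (h i) - Inf (h i)) < d"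
      using small by (simp add: reindex)
    moreover have "disjoint_family_on (\<lambda>i. {Inf (h i)<..<Sup (h i)}) {..<card D}"
      unfolding disjoint_family_on_def
    proof (intro ballI impI)
      fix i j assume ij: "i \<in> {..<card D}" "j \<in> {..<card D}" "i \<noteq> j"
      then have "h i \<noteq> h j"
        using h by (auto simp: bij_betw_def inj_on_def)
      then have "interior (h i) \<inter> interior (h j) = {}"
        using division_ofD(5)[OF D] hD ij by auto
      then show "{Inf (h i)<..<Sup (h i)} \<inter> {Inf (h j)<..<Sup (h j)} = {}"
        using hI ij by (metis interior_atLeastAtMost_real lessThan_iff)
    qed
    moreover have "\<forall>i<card D. Inf (h i) \<le> Sup (h i) \<and> {Inf (h i)..Sup (h i)} \<subseteq> I"
      using hI hD sub by blast
    ultimately show "(\<Sum>K\<in>D. \<bar>f (Sup K) - f (Inf K)\<bar>) < e"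
      unfolding reindex by (intro ac[rule_format] conjI) auto
  qed
qed

lemma sum_increments_division:
  fixes f :: "real \<Rightarrow> real"
  assumes "q division_of {a..b}" and "a \<le> b"
  shows "(\<Sum>K\<in>q. f (Sup K) - f (Inf K)) = f b - f a"
proof -
  \<comment> \<open>The tags do not enter the sum of increments; left endpoints merely supply a
    tagged division, over which increments telescope.\<close>
  let ?p = "(\<lambda>K. (Inf K, K)) ` q"
  have "Inf K \<in> K" if K: "K \<in> q" for K
  proof -
    obtain u v where "K = {u..v}" "K \<noteq> {}"
      using division_ofD(3,4)[OF assms(1) K] by auto
    then show ?thesis by auto
  qed
  moreover have "\<Union>{K. \<exists>x. (x, K) \<in> ?p} = \<Union>q"
    by blast
  moreover have "interior K1 \<inter> interior K2 = {}"
    if "(x1, K1) \<in> ?p" "(x2, K2) \<in> ?p" "(x1, K1) \<noteq> (x2, K2)" for x1 K1 x2 K2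
    using that by (intro division_ofD(5)[OF assms(1)]) auto
  ultimately have "?p tagged_division_of {a..b}"
    using division_ofD(1-4,6)[OF assms(1)] by (intro tagged_division_ofI) auto
  from additive_tagged_division_1[OF assms(2) this, of f]
  show ?thesis
    by (simp add: sum.reindex inj_on_def)
qed

text \<open>Inside each interval of \<open>P\<close> the members of \<open>Q\<close> extend to a
  full division. Length and increment are both additive over divisions, so the two differences are
  exactly the total length and the total increment of the added intervals. The former is below
  \<open>d\<close>, and absolute continuity then makes the latter small.\<close>

lemma absolutely_continuous_on_refine:
  assumes "absolutely_continuous_on I f" and "0 < e"
  shows "\<exists>d>0. \<forall>P Q. finite P \<and> disjoint P \<and> (\<forall>K\<in>P. K \<subseteq> I \<and> (\<exists>u v. u \<le> v \<and> K = {u..v})) \<and>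
      Q division_of \<Union>Q \<and> (\<forall>J\<in>Q. \<exists>K\<in>P. J \<subseteq> K) \<and>
      sum (measure lborel) P - sum (measure lborel) Q < d
    \<longrightarrow> \<bar>(\<Sum>K\<in>P. f (Sup K) - f (Inf K)) - (\<Sum>K\<in>Q. f (Sup K) - f (Inf K))\<bar> < e"
proof -
  obtain d where d: "0 < d" and ac: "\<And>D. D division_of \<Union>D \<Longrightarrow> \<Union>D \<subseteq> I \<Longrightarrow> sum (measure lborel) D < d
      \<Longrightarrow> (\<Sum>K\<in>D. \<bar>f (Sup K) - f (Inf K)\<bar>) < e"
    using absolutely_continuous_on_division[OF assms] by blast
  show ?thesis
  proof (intro exI[of _ d] conjI d allI impI, elim conjE)
    fix P Q :: "real set set"
    assume fin: "finite P" and disj: "disjoint P"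
      and P': "\<forall>K\<in>P. K \<subseteq> I \<and> (\<exists>u v. u \<le> v \<and> K = {u..v})"
      and Q: "Q division_of \<Union>Q" and QP: "\<forall>J\<in>Q. \<exists>K\<in>P. J \<subseteq> K"
      and small: "sum (measure lborel) P - sum (measure lborel) Q < d"
    note P = P'[rule_format]
    define QK where "QK K = {J \<in> Q. J \<subseteq> K}" for K
    have "\<exists>q. QK K \<subseteq> q \<and> q division_of K" if K: "K \<in> P" for K
    proof -
      obtain u v where uv: "K = cbox u v" using P[OF K] by auto
      have "QK K division_of \<Union>(QK K)" "\<Union>(QK K) \<subseteq> cbox u v"
        using division_of_subset[OF Q, of "QK K"] by (auto simp: QK_def uv)
      then show ?thesis
        using partial_division_extend_interval uv by metis
    qed
    then obtain q where q: "\<And>K. K \<in> P \<Longrightarrow> QK K \<subseteq> q K" "\<And>K. K \<in> P \<Longrightarrow> q K division_of K"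
      by metis
    define R where "R = (\<Union>K\<in>P. q K - QK K)"
    have finq: "finite (q K)" if "K \<in> P" for K
      using q(2)[OF that] by auto
    have qK: "J \<subseteq> K" "J \<noteq> {}" if "K \<in> P" "J \<in> q K" for J K
      using division_ofD(2,3)[OF q(2)[OF that(1)] that(2)] by auto
    \<comment> \<open>Members of a division are nonempty and the intervals of \<open>P\<close> are
      disjoint, so nothing is counted for two intervals of \<open>P\<close>.\<close>
    have q_disj: "K = K'" if "K \<in> P" "K' \<in> P" "J \<in> q K" "J' \<in> q K'" "J \<inter> J' \<noteq> {}" for K K' J J'
    proof (rule ccontr)
      assume "K \<noteq> K'"
      then have "K \<inter> K' = {}" using disj that(1,2) by (auto simp: pairwise_def disjnt_def)
      then show False using qK that by blast
    qed
    have q_Int: "q K \<inter> q K' = {}" if "K \<in> P" "K' \<in> P" "K \<noteq> K'" for K K'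
      using q_disj[OF that(1,2)] qK(2)[OF that(1)] that(3) by fast
    have Q_eq: "Q = (\<Union>K\<in>P. QK K)"
      using QP by (auto simp: QK_def)
    \<comment> \<open>Used twice below, with length and with increment as the additive function
      \<open>g\<close>.\<close>
    have split: "sum g P = sum g Q + sum g R"
      if g: "\<And>u v p. u \<le> v \<Longrightarrow> p division_of {u..v} \<Longrightarrow> sum g p = g {u..v}" for g :: "real set \<Rightarrow> real"
    proof -
      have "sum g P = (\<Sum>K\<in>P. sum g (q K))"
        using P q(2) g by (intro sum.cong refl) metis
      also have "\<dots> = (\<Sum>K\<in>P. sum g (QK K) + sum g (q K - QK K))"
        using sum.subset_diff[OF q(1) finq] by (intro sum.cong) (auto simp: add.commute)
      also have "\<dots> = (\<Sum>K\<in>P. sum g (QK K)) + (\<Sum>K\<in>P. sum g (q K - QK K))"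
        by (rule sum.distrib)
      also have "(\<Sum>K\<in>P. sum g (QK K)) = sum g Q"
        unfolding Q_eq
      proof (rule sum.UNION_disjoint[symmetric, OF fin])
        show "\<forall>K\<in>P. finite (QK K)" using finq q(1) finite_subset by blast
        show "\<forall>K\<in>P. \<forall>K'\<in>P. K \<noteq> K' \<longrightarrow> QK K \<inter> QK K' = {}"
          using q_Int q(1) by blast
      qed
      also have "(\<Sum>K\<in>P. sum g (q K - QK K)) = sum g R"
        unfolding R_def
      proof (rule sum.UNION_disjoint[symmetric, OF fin])
        show "\<forall>K\<in>P. finite (q K - QK K)" using finq by blast
        show "\<forall>K\<in>P. \<forall>K'\<in>P. K \<noteq> K' \<longrightarrow> (q K - QK K) \<inter> (q K' - QK K') = {}"
          using q_Int by blast
      qed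
      finally show ?thesis .
    qed
    have R: "R division_of \<Union>R"
    proof (rule division_ofI)
      show "finite R" unfolding R_def using fin finq by blast
      show "K \<subseteq> \<Union>R" if "K \<in> R" for K using that by blast
      show "K \<noteq> {}" if "K \<in> R" for K using that qK by (auto simp: R_def)
      show "\<exists>a b. K = cbox a b" if "K \<in> R" for K
        using that q(2) division_ofD(4) unfolding R_def by blast
      show "interior J \<inter> interior J' = {}" if JJ: "J \<in> R" "J' \<in> R" "J \<noteq> J'" for J J'
      proof -
        obtain K K' where KK: "K \<in> P" "J \<in> q K" "K' \<in> P" "J' \<in> q K'"
          using JJ by (auto simp: R_def)
        show ?thesis
        proof (cases "K = K'")
          case True
          then show ?thesis using division_ofD(5)[OF q(2)] KK JJ by blast
        next
          case False
          then have "J \<inter> J' = {}" using q_disj KK by blast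
          then show ?thesis using interior_subset by blast
        qed
      qed
    qed auto
    have "sum (measure lborel) P = sum (measure lborel) Q + sum (measure lborel) R"
      by (intro split) (metis additive_content_division box_real(2))
    moreover have "\<Union>R \<subseteq> I"
      using P qK(1) unfolding R_def by blast
    ultimately have "(\<Sum>K\<in>R. \<bar>f (Sup K) - f (Inf K)\<bar>) < e"
      using small by (intro ac[OF R]) auto
    moreover have "(\<Sum>K\<in>P. f (Sup K) - f (Inf K)) =
        (\<Sum>K\<in>Q. f (Sup K) - f (Inf K)) + (\<Sum>K\<in>R. f (Sup K) - f (Inf K))"
      using sum_increments_division by (intro split) auto
    moreover have "\<bar>\<Sum>K\<in>R. f (Sup K) - f (Inf K)\<bar> \<le> (\<Sum>K\<in>R. \<bar>f (Sup K) - f (Inf K)\<bar>)"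
      by (rule sum_abs)
    ultimately show "\<bar>(\<Sum>K\<in>P. f (Sup K) - f (Inf K)) - (\<Sum>K\<in>Q. f (Sup K) - f (Inf K))\<bar> < e"
      by linarith
  qed
qed

lemma absolutely_continuous_on_subset:
  assumes "absolutely_continuous_on I f" and "J \<subseteq> I"
  shows "absolutely_continuous_on J f"
  unfolding absolutely_continuous_on_def
proof (intro allI impI)
  fix e :: real assume "0 < e"
  then have "\<exists>d>0. \<forall>(n::nat) a b. (\<forall>i<n. a i \<le> b i \<and> {a i..b i} \<subseteq> I) \<and>
      disjoint_family_on (\<lambda>i. {a i<..<b i}) {..<n} \<and> (\<Sum>i<n. b i - a i) < d
      \<longrightarrow> (\<Sum>i<n. \<bar>f (b i) - f (a i)\<bar>) < e"
    using assms(1) unfolding absolutely_continuous_on_def by (elim allE impE)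
  then obtain d where d: "0 < d"
    and ac: "\<forall>(n::nat) a b. (\<forall>i<n. a i \<le> b i \<and> {a i..b i} \<subseteq> I) \<and>
      disjoint_family_on (\<lambda>i. {a i<..<b i}) {..<n} \<and> (\<Sum>i<n. b i - a i) < d
      \<longrightarrow> (\<Sum>i<n. \<bar>f (b i) - f (a i)\<bar>) < e"
    by (elim exE conjE)
  show "\<exists>d>0. \<forall>(n::nat) a b. (\<forall>i<n. a i \<le> b i \<and> {a i..b i} \<subseteq> J) \<and>
      disjoint_family_on (\<lambda>i. {a i<..<b i}) {..<n} \<and> (\<Sum>i<n. b i - a i) < d
      \<longrightarrow> (\<Sum>i<n. \<bar>f (b i) - f (a i)\<bar>) < e"
  proof (intro exI[of _ d] conjI d allI impI ac[rule_format])
    fix n i :: nat and a b :: "nat \<Rightarrow> real"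
    assume "(\<forall>i<n. a i \<le> b i \<and> {a i..b i} \<subseteq> J) \<and>
      disjoint_family_on (\<lambda>i. {a i<..<b i}) {..<n} \<and> (\<Sum>i<n. b i - a i) < d" and "i < n"
    then show "a i \<le> b i" "{a i..b i} \<subseteq> I" using assms(2) by blast+
  qed simp_all
qed

lemma absolutely_continuous_on_imp_continuous_on:
  assumes "absolutely_continuous_on {a..b} f"
  shows "continuous_on {a..b} f"
  unfolding continuous_on_iff
proof (intro ballI allI impI)
  fix x e :: real assume x: "x \<in> {a..b}" and "0 < e"
  obtain d where d: "0 < d"
    and ac: "\<And>D. D division_of \<Union>D \<Longrightarrow> \<Union>D \<subseteq> {a..b} \<Longrightarrow> sum (measure lborel) D < d
      \<Longrightarrow> (\<Sum>K\<in>D. \<bar>f (Sup K) - f (Inf K)\<bar>) < e"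
    using absolutely_continuous_on_division[OF assms \<open>0 < e\<close>] by blast
  have *: "\<bar>f v - f u\<bar> < e" if "u \<in> {a..b}" "v \<in> {a..b}" "u \<le> v" "v - u < d" for u v
    using ac[of "{{u..v}}"] division_of_self[of u v] that by auto
  show "\<exists>d>0. \<forall>y\<in>{a..b}. dist y x < d \<longrightarrow> dist (f y) (f x) < e"
  proof (intro exI[of _ d] conjI d ballI impI)
    fix y assume "y \<in> {a..b}" "dist y x < d"
    then show "dist (f y) (f x) < e"
      using *[of x y] *[of y x] x by (cases "x \<le> y") (auto simp: dist_real_def abs_minus_commute)
  qed
qed

subsection \<open>Almost everywhere differentiability\<close>

text \<open>\<open>E\<close> need not be measurable: Vitali's theorem leaves only a null part of it
  uncovered. The disjoint intervals lie in the bounded set \<open>U\<close>, so finitely many of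
  them carry all but \<open>d\<close> of the total length. Keeping \<open>\<Phi>\<close> abstract
  lets slope bounds, gauges and containment conditions be imposed on the intervals.\<close>

lemma vitali_finite_cover:
  fixes E U :: "real set"
  assumes U: "open U" "bounded U" "E \<subseteq> U" and "0 < d"
    and small: "\<And>x \<delta>. x \<in> E \<Longrightarrow> 0 < \<delta> \<Longrightarrow> \<exists>u v. u < v \<and> u \<le> x \<and> x \<le> v \<and> v - u < \<delta> \<and> \<Phi> u v"
  obtains P N where "finite P" "disjoint P"
    "\<And>K. K \<in> P \<Longrightarrow> \<exists>u v. u < v \<and> K = {u..v} \<and> {u..v} \<subseteq> U \<and> \<Phi> u v"
    "N \<in> lmeasurable" "measure lebesgue N < d" "E \<subseteq> \<Union>P \<union> N"
proof -
  define W where "W = {(u, v). u < v \<and> {u..v} \<subseteq> U \<and> \<Phi> u v}"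
  \<comment> \<open>The covering theorem is about closed balls that contain the point, not
    necessarily as centre, so an interval is recast as the ball about its midpoint.\<close>
  define m where "m = (\<lambda>(u::real, v). (u + v) / 2)"
  define r where "r = (\<lambda>(u::real, v). (v - u) / 2)"
  have cb: "cball (m i) (r i) = {fst i..snd i}" for i
  proof -
    have "(fst i + snd i) / 2 - (snd i - fst i) / 2 = fst i" "(fst i + snd i) / 2 + (snd i - fst i) / 2 = snd i"
      by (simp_all add: field_simps)
    then show ?thesis
      by (simp add: m_def r_def cball_eq_atLeastAtMost case_prod_beta)
  qed
  have r: "0 < r i" if "i \<in> W" for i
    using that by (auto simp: W_def r_def)
  have fine: "\<exists>i. i \<in> W \<and> x \<in> cball (m i) (r i) \<and> r i < \<delta>" if x: "x \<in> E" "0 < \<delta>" for x \<delta>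
  proof -
    obtain \<eta> where \<eta>: "0 < \<eta>" "ball x \<eta> \<subseteq> U"
      using U x by (meson open_contains_ball subsetD)
    obtain u v where uv: "u < v" "u \<le> x" "x \<le> v" "v - u < min \<delta> \<eta>" "\<Phi> u v"
      using small[of x "min \<delta> \<eta>"] x \<eta> by auto
    then have "{u..v} \<subseteq> ball x \<eta>"
      by (auto simp: dist_real_def)
    then have "(u, v) \<in> W" using uv \<eta> by (auto simp: W_def)
    moreover have "x \<in> cball (m (u, v)) (r (u, v))" using uv by (simp only: cb) auto
    moreover have "r (u, v) < \<delta>" using uv by (simp add: r_def)
    ultimately show ?thesis by blast
  qed
  obtain C where C: "countable C" "C \<subseteq> W"
    "pairwise (\<lambda>i j. disjnt (cball (m i) (r i)) (cball (m j) (r j))) C"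
    "negligible (E - (\<Union>i\<in>C. cball (m i) (r i)))"
    by (rule Vitali_covering_theorem_cballs[of W r E m, OF r fine])
  define D where "D = (\<lambda>i. {fst i..snd i}) ` C"
  have UnD: "(\<Union>i\<in>C. cball (m i) (r i)) = \<Union>D"
    by (auto simp: D_def cb)
  have cD: "countable D" using C(1) by (simp add: D_def)
  have mD: "K \<in> lmeasurable" if "K \<in> D" for K
    using that by (auto simp: D_def)
  have DU: "\<Union>D \<subseteq> U" using C(2) by (fastforce simp: D_def W_def)
  have mU: "U \<in> lmeasurable" using U lmeasurable_open by blast
  have mUnD: "\<Union>D \<in> lmeasurable"
  proof (rule fmeasurableI2[OF mU DU])
    show "\<Union>D \<in> sets lebesgue" using cD mD by (intro sets.countable_Union) auto
  qed
  have bound: "measure lebesgue (\<Union>D') \<le> measure lebesgue U" if "D' \<subseteq> D" "finite D'" for D'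
    using that mD DU mU by (intro measure_mono_fmeasurable) (auto intro!: sets.finite_Union)
  obtain P where P: "P \<subseteq> D" "finite P" "measure lebesgue (\<Union>D) - d < measure lebesgue (\<Union>P)"
    by (rule measure_countable_Union_approachable[OF cD \<open>0 < d\<close> mD bound])
  have mP: "\<Union>P \<in> lmeasurable" using P mD by (intro fmeasurable.finite_Union) auto
  \<comment> \<open>The discarded intervals together with the uncovered null part of
    \<open>E\<close>; the latter is measurable because it is negligible, whatever \<open>E\<close>
    is.\<close>
  define N where "N = (\<Union>D - \<Union>P) \<union> (E - \<Union>D)"
  have negl: "negligible (E - \<Union>D)" using C(4) UnD by simp
  have mDP: "\<Union>D - \<Union>P \<in> lmeasurable" by (rule fmeasurable.Diff[OF mUnD mP])
  show thesis
  proof (rule that)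
    show "finite P" by fact
    show "disjoint P"
    proof (rule pairwiseI)
      fix K K' assume "K \<in> P" "K' \<in> P" "K \<noteq> K'"
      then obtain i j where "i \<in> C" "j \<in> C" "i \<noteq> j" "K = {fst i..snd i}" "K' = {fst j..snd j}"
        using P(1) unfolding D_def by blast
      then show "disjnt K K'"
        using C(3) unfolding cb pairwise_def by blast
    qed
    show "\<exists>u v. u < v \<and> K = {u..v} \<and> {u..v} \<subseteq> U \<and> \<Phi> u v" if K: "K \<in> P" for K
    proof -
      obtain i where "i \<in> C" "K = {fst i..snd i}"
        using K P(1) unfolding D_def by blast
      then show ?thesis using C(2) by (auto simp: W_def)
    qed
    show "N \<in> lmeasurable"
      unfolding N_def by (intro fmeasurable.Un mDP negligible_imp_measurable negl)
    have "measure lebesgue N = measure lebesgue (\<Union>D - \<Union>P)"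
      unfolding N_def using mDP negl by (simp add: measure_Un_null_set fmeasurableD negligible_iff_null_sets)
    also have "\<dots> = measure lebesgue (\<Union>D) - measure lebesgue (\<Union>P)"
      using P mUnD mP by (intro measurable_measure_Diff) (auto simp: fmeasurableD)
    also have "\<dots> < d" using P(3) by simp
    finally show "measure lebesgue N < d" .
    show "E \<subseteq> \<Union>P \<union> N" by (auto simp: N_def)
  qed
qed

section \<open>Finite disjoint families of compact intervals\<close>

lemma disjoint_Icc_division:
  fixes P :: "real set set"
  assumes "finite P" and "disjoint P" and "\<forall>K\<in>P. \<exists>u v. u < v \<and> K = {u..v}"
  shows "P division_of \<Union>P"
proof (rule division_ofI)
  show "K \<noteq> {}" "\<exists>a b. K = cbox a b" if "K \<in> P" for K
    using assms(3) that by auto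
  show "interior K \<inter> interior K' = {}" if "K \<in> P" "K' \<in> P" "K \<noteq> K'" for K K'
  proof -
    have "K \<inter> K' = {}"
      using assms(2) that by (auto simp: pairwise_def disjnt_def)
    then show ?thesis
      using interior_subset by blast
  qed
qed (use assms(1) in auto)

lemma measure_disjoint_Icc_Union:
  fixes P :: "real set set"
  assumes "finite P" and "disjoint P" and "\<forall>K\<in>P. \<exists>u v. u < v \<and> K = {u..v}"
  shows "\<Union>P \<in> lmeasurable" and "measure lebesgue (\<Union>P) = sum (measure lborel) P"
proof -
  have P: "K \<in> lmeasurable" "measure lebesgue K = measure lborel K" if "K \<in> P" for K
    using assms(3) that by auto
  show "\<Union>P \<in> lmeasurable"
    using P assms(1) by (intro fmeasurable.finite_Union) auto
  have "pairwise (\<lambda>S T. negligible (S \<inter> T)) P"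
    using assms(2) by (auto simp: pairwise_def disjnt_def)
  then have "measure lebesgue (\<Union>P) = sum (measure lebesgue) P"
    using P assms(1) by (intro measure_negligible_finite_Union) auto
  then show "measure lebesgue (\<Union>P) = sum (measure lborel) P"
    using P by simp
qed

text \<open>Vitali intervals of slope at most \<open>p\<close>, and inside them Vitali intervals of slope at least \<open>q\<close>,
  both fill \<open>E\<close> up to small measure; by absolute continuity the increments over the two families
  nearly agree. Since \<open>E\<close> need not be measurable, its size is measured by the infimum \<open>m\<close> over
  open supersets.\<close>

lemma negligible_oscillating_slopes:
  assumes ac: "absolutely_continuous_on {a..b} f" and "p < q" and E: "E \<subseteq> {a<..<b}"
    and lo: "\<And>x \<delta>. x \<in> E \<Longrightarrow> 0 < \<delta> \<Longrightarrow>
      \<exists>u v. u < v \<and> u \<le> x \<and> x \<le> v \<and> v - u < \<delta> \<and> f v - f u \<le> p * (v - u)"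
    and hi: "\<And>x \<delta>. x \<in> E \<Longrightarrow> 0 < \<delta> \<Longrightarrow>
      \<exists>u v. u < v \<and> u \<le> x \<and> x \<le> v \<and> v - u < \<delta> \<and> q * (v - u) \<le> f v - f u"
  shows "negligible E"
proof -
  define M where "M = {measure lebesgue U | U. open U \<and> E \<subseteq> U \<and> U \<subseteq> {a<..<b}}"
  define m where "m = Inf M"
  have M0: "M \<noteq> {}" using E by (auto simp: M_def intro!: exI[of _ "{a<..<b}"])
  have bdd: "bdd_below M" by (auto simp: M_def intro!: bdd_belowI[of _ 0])
  \<comment> \<open>In the constant, 1 comes from the gap between the increments over
    \<open>P\<close> and \<open>Q\<close>, 4 * |p| from the excess length of \<open>P\<close> over
    \<open>Q\<close> at slope \<open>p\<close>, and 3 * (q - p) from the excess of \<open>m\<close>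
    over the length of \<open>Q\<close>.\<close>
  have key: "(q - p) * m \<le> (1 + 4 * \<bar>p\<bar> + 3 * (q - p)) * e" if e: "0 < e" for e
  proof -
    obtain d0 where d0: "0 < d0"
      and refine: "\<forall>P Q. finite P \<and> disjoint P \<and> (\<forall>K\<in>P. K \<subseteq> {a..b} \<and> (\<exists>u v. u \<le> v \<and> K = {u..v})) \<and>
          Q division_of \<Union>Q \<and> (\<forall>J\<in>Q. \<exists>K\<in>P. J \<subseteq> K) \<and>
          sum (measure lborel) P - sum (measure lborel) Q < d0
        \<longrightarrow> \<bar>(\<Sum>K\<in>P. f (Sup K) - f (Inf K)) - (\<Sum>K\<in>Q. f (Sup K) - f (Inf K))\<bar> < e"
      using absolutely_continuous_on_refine[OF ac e] by (elim exE conjE)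
    \<comment> \<open>The length of \<open>P\<close> exceeds that of \<open>Q\<close> by less than 4
      * d: one \<open>d\<close> each for the excess of \<open>U\<close> over \<open>m\<close>, the
      remainders \<open>N\<close> and \<open>N2\<close>, and the open superset \<open>V\<close> of
      \<open>Z\<close>.\<close>
    define d where "d = min e (d0 / 4)"
    have d: "0 < d" "d \<le> e" "4 * d \<le> d0" using d0 e by (auto simp: d_def)
    have "Inf M < m + d" using d by (simp add: m_def)
    then obtain U where U: "open U" "E \<subseteq> U" "U \<subseteq> {a<..<b}" "measure lebesgue U < m + d"
      using cInf_lessD[OF M0] unfolding M_def by blast
    have bU: "bounded U" by (rule bounded_subset[OF _ U(3)]) simp
    have mU: "U \<in> lmeasurable" using U(1) bU lmeasurable_open by blast
    obtain P N where P: "finite P" "disjoint P"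
      "\<And>K. K \<in> P \<Longrightarrow> \<exists>u v. u < v \<and> K = {u..v} \<and> {u..v} \<subseteq> U \<and> f v - f u \<le> p * (v - u)"
      and N: "N \<in> lmeasurable" "measure lebesgue N < d" "E \<subseteq> \<Union>P \<union> N"
      by (rule vitali_finite_cover[OF U(1) bU U(2) d(1) lo]) auto
    \<comment> \<open>Around an interior point of some \<open>K\<close> in \<open>P\<close>, short
      intervals stay inside that \<open>K\<close>, which makes the second family refine the first.
      The endpoints lost in this way form the finite set \<open>F\<close>.\<close>
    define U2 where "U2 = (\<Union>K\<in>P. interior K)"
    have U2: "open U2" by (auto simp: U2_def)
    have U2U: "U2 \<subseteq> U" using P(3) interior_subset by (fastforce simp: U2_def)
    have bU2: "bounded U2" using bU U2U bounded_subset by blast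
    have hi2: "\<exists>u v. u < v \<and> u \<le> x \<and> x \<le> v \<and> v - u < \<delta> \<and> (q * (v - u) \<le> f v - f u \<and> (\<exists>K\<in>P. {u..v} \<subseteq> K))"
      if x: "x \<in> E \<inter> U2" and "0 < \<delta>" for x \<delta>
    proof -
      obtain K where K: "K \<in> P" "x \<in> interior K" using x by (auto simp: U2_def)
      obtain \<eta> where \<eta>: "0 < \<eta>" "ball x \<eta> \<subseteq> K" using K(2) by (auto simp: mem_interior)
      obtain u v where uv: "u < v" "u \<le> x" "x \<le> v" "v - u < min \<delta> \<eta>" "q * (v - u) \<le> f v - f u"
        using hi[of x "min \<delta> \<eta>"] x \<open>0 < \<delta>\<close> \<eta>(1) by auto
      then have "{u..v} \<subseteq> ball x \<eta>" by (auto simp: dist_real_def)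
      then show ?thesis using uv K(1) \<eta>(2) by (intro exI[of _ u] exI[of _ v]) auto
    qed
    obtain Q N2 where Q: "finite Q" "disjoint Q"
      "\<And>K. K \<in> Q \<Longrightarrow> \<exists>u v. u < v \<and> K = {u..v} \<and> {u..v} \<subseteq> U2 \<and>
          (q * (v - u) \<le> f v - f u \<and> (\<exists>K\<in>P. {u..v} \<subseteq> K))"
      and N2: "N2 \<in> lmeasurable" "measure lebesgue N2 < d" "E \<inter> U2 \<subseteq> \<Union>Q \<union> N2"
      by (rule vitali_finite_cover[OF U2 bU2 Int_lower2 d(1) hi2]) auto
    have Picc: "\<forall>K\<in>P. \<exists>u v. u < v \<and> K = {u..v}" using P(3) by blast
    have Qicc: "\<forall>K\<in>Q. \<exists>u v. u < v \<and> K = {u..v}" using Q(3) by blast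
    note mP = measure_disjoint_Icc_Union[OF P(1,2) Picc]
    note mQ = measure_disjoint_Icc_Union[OF Q(1,2) Qicc]
    let ?LP = "sum (measure lborel) P" and ?LQ = "sum (measure lborel) Q"
    have "\<Union>P \<subseteq> U" using P(3) by blast
    then have LP: "?LP \<le> measure lebesgue U"
      unfolding mP(2)[symmetric] using mP(1) mU by (intro measure_mono_fmeasurable) auto
    define F where "F = Inf ` P \<union> Sup ` P"
    have "finite F" using P(1) by (simp add: F_def)
    have PF: "\<Union>P \<subseteq> U2 \<union> F"
    proof
      fix x assume "x \<in> \<Union>P"
      then obtain K where K: "K \<in> P" "x \<in> K" by blast
      obtain u v where "u < v" "K = {u..v}" using Picc K(1) by blast
      then have "x \<in> interior K \<or> x = Inf K \<or> x = Sup K" using K(2) by auto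
      then show "x \<in> U2 \<union> F" using K(1) by (auto simp: U2_def F_def)
    qed
    have negF: "negligible F" using \<open>finite F\<close> by (rule negligible_finite)
    define Z where "Z = \<Union>Q \<union> N2 \<union> N \<union> F"
    have EZ: "E \<subseteq> Z" using N(3) N2(3) PF unfolding Z_def by blast
    have mZ: "Z \<in> lmeasurable"
      unfolding Z_def using mQ(1) N(1) N2(1) negF by (intro fmeasurable.Un) (auto intro: negligible_imp_measurable)
    have "measure lebesgue Z \<le> measure lebesgue (\<Union>Q \<union> N2 \<union> N) + measure lebesgue F"
      unfolding Z_def using mQ(1) N(1) N2(1) negF
      by (intro measure_Un_le) (auto intro: fmeasurableD negligible_imp_sets)
    also have "\<dots> \<le> ?LQ + measure lebesgue N2 + measure lebesgue N"
      using mQ N(1) N2(1) negF measure_Un_le[of "\<Union>Q" lebesgue N2] measure_Un_le[of "\<Union>Q \<union> N2" lebesgue N]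
      by (simp add: negligible_imp_measure0 fmeasurableD)
    finally have Z: "measure lebesgue Z < ?LQ + 2 * d" using N(2) N2(2) by simp
    \<comment> \<open>\<open>m\<close> is an infimum over open sets, so \<open>Z\<close> can be
      compared with it only after a slight enlargement to an open set.\<close>
    obtain V where V: "open V" "Z \<subseteq> V" and VZ: "V - Z \<in> lmeasurable" "emeasure lebesgue (V - Z) < ennreal d"
      using sets_lebesgue_outer_open[OF fmeasurableD[OF mZ] d(1)] by blast
    have VZd: "measure lebesgue (V - Z) < d"
      using VZ d(1) by (metis emeasure_eq_measure2 ennreal_leI linorder_not_le)
    have V_eq: "V = Z \<union> (V - Z)" using V(2) by blast
    have mV: "V \<in> lmeasurable" using fmeasurable.Un[OF mZ VZ(1)] V_eq by simp
    have Vd: "measure lebesgue V < measure lebesgue Z + d"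
      using measure_Un_le[OF fmeasurableD[OF mZ] fmeasurableD[OF VZ(1)]] V_eq VZd by simp
    have "measure lebesgue (V \<inter> {a<..<b}) \<in> M"
      unfolding M_def
      by (intro CollectI exI[of _ "V \<inter> {a<..<b}"] conjI open_Int V(1) refl open_greaterThanLessThan)
        (use V(2) EZ E in blast)+
    then have "m \<le> measure lebesgue (V \<inter> {a<..<b})"
      unfolding m_def using bdd by (rule cInf_lower)
    also have "\<dots> \<le> measure lebesgue V"
      using mV by (intro measure_mono_fmeasurable) (auto intro: fmeasurableD)
    finally have mLQ: "m < ?LQ + 3 * d" using Vd Z by simp
    have incrP: "(\<Sum>K\<in>P. f (Sup K) - f (Inf K)) \<le> p * ?LP"
      unfolding sum_distrib_left
    proof (rule sum_mono)
      fix K assume "K \<in> P"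
      then obtain u v where "u < v" "K = {u..v}" "f v - f u \<le> p * (v - u)" using P(3) by blast
      then show "f (Sup K) - f (Inf K) \<le> p * measure lborel K" by simp
    qed
    have incrQ: "q * ?LQ \<le> (\<Sum>K\<in>Q. f (Sup K) - f (Inf K))"
      unfolding sum_distrib_left
    proof (rule sum_mono)
      fix K assume "K \<in> Q"
      then obtain u v where "u < v" "K = {u..v}" "q * (v - u) \<le> f v - f u" using Q(3) by blast
      then show "q * measure lborel K \<le> f (Sup K) - f (Inf K)" by simp
    qed
    have diff: "?LP - ?LQ < 4 * d" using LP U(4) mLQ by simp
    have "\<Union>Q \<subseteq> \<Union>P" using Q(3) by blast
    then have "?LQ \<le> ?LP"
      unfolding mP(2)[symmetric] mQ(2)[symmetric] using mP(1) mQ(1)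
      by (intro measure_mono_fmeasurable) (auto intro: fmeasurableD)
    then have "p * (?LP - ?LQ) \<le> \<bar>p\<bar> * (4 * e)"
      using diff d by (intro mult_mono) auto
    moreover have "\<bar>(\<Sum>K\<in>P. f (Sup K) - f (Inf K)) - (\<Sum>K\<in>Q. f (Sup K) - f (Inf K))\<bar> < e"
    proof (rule refine[rule_format], intro conjI ballI P(1,2))
      show "K \<subseteq> {a..b}" "\<exists>u v. u \<le> v \<and> K = {u..v}" if "K \<in> P" for K
        using P(3)[OF that] U(3) by (force intro: less_imp_le)+
      show "Q division_of \<Union>Q" by (rule disjoint_Icc_division[OF Q(1,2) Qicc])
      show "\<exists>K\<in>P. J \<subseteq> K" if "J \<in> Q" for J using Q(3)[OF that] by blast
    qed (use diff d in linarith)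
    ultimately have "(q - p) * ?LQ \<le> (1 + 4 * \<bar>p\<bar>) * e"
      using incrP incrQ by (simp add: algebra_simps)
    moreover have "(q - p) * m \<le> (q - p) * (?LQ + 3 * e)"
      using mLQ d \<open>p < q\<close> by (intro mult_left_mono) auto
    ultimately show ?thesis by (simp add: algebra_simps)
  qed
  define c where "c = 1 + 4 * \<bar>p\<bar> + 3 * (q - p)"
  have c: "0 < c" using \<open>p < q\<close> by (simp add: c_def add_pos_nonneg)
  have "(q - p) * m \<le> 0"
  proof (rule field_le_epsilon)
    fix e :: real assume "0 < e"
    then show "(q - p) * m \<le> 0 + e"
      using key[of "e / c", folded c_def] c by simp
  qed
  then have "m \<le> 0" using \<open>p < q\<close> by (simp add: mult_le_0_iff)
  show ?thesis
    unfolding negligible_outer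
  proof (intro allI impI)
    fix e :: real assume "0 < e"
    then have "Inf M < e" using \<open>m \<le> 0\<close> by (simp add: m_def)
    then obtain U where U: "open U" "E \<subseteq> U" "U \<subseteq> {a<..<b}" "measure lebesgue U < e"
      using cInf_lessD[OF M0] unfolding M_def by blast
    have "bounded U" by (rule bounded_subset[OF _ U(3)]) simp
    then show "\<exists>T. E \<subseteq> T \<and> T \<in> lmeasurable \<and> measure lebesgue T < e"
      using U lmeasurable_open by blast
  qed
qed

text \<open>Intervals of slope at least M > 0 and total length L have total increment at least M *
  L. Absolute continuity keeps this below 1 as soon as L < d, whence L < 1 / M. Negligibility is a
  local property, so \<open>E\<close> may be cut down to pieces short enough to ensure L <
  d.\<close>

lemma negligible_unbounded_slopes:
  assumes ac: "absolutely_continuous_on {a..b} f" and E: "E \<subseteq> {a<..<b}"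
    and hi: "\<And>x \<delta> M. x \<in> E \<Longrightarrow> 0 < \<delta> \<Longrightarrow>
      \<exists>u v. u < v \<and> u \<le> x \<and> x \<le> v \<and> v - u < \<delta> \<and> M * (v - u) \<le> f v - f u"
  shows "negligible E"
proof -
  obtain d where d: "0 < d"
    and small: "\<And>D. D division_of \<Union>D \<Longrightarrow> \<Union>D \<subseteq> {a..b} \<Longrightarrow> sum (measure lborel) D < d
      \<Longrightarrow> (\<Sum>K\<in>D. \<bar>f (Sup K) - f (Inf K)\<bar>) < 1"
    using absolutely_continuous_on_division[OF ac zero_less_one] by blast
  have "\<exists>U. openin (top_of_set E) U \<and> y \<in> U \<and> negligible U" if y: "y \<in> E" for y
  proof (intro exI conjI)
    \<comment> \<open>Radius \<open>d / 3\<close> bounds the length of \<open>B\<close> by 2 * d /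
      3, strictly below \<open>d\<close>.\<close>
    define B where "B = ball y (d / 3) \<inter> {a<..<b}"
    have B: "open B" "bounded B" by (auto simp: B_def intro: bounded_subset)
    have mB: "B \<in> lmeasurable" using B lmeasurable_open by blast
    have "B \<subseteq> {y - d / 3..y + d / 3}"
      by (auto simp: B_def ball_eq_greaterThanLessThan)
    then have "measure lebesgue B \<le> measure lebesgue {y - d / 3..y + d / 3}"
      using mB by (intro measure_mono_fmeasurable) (auto simp: fmeasurableD)
    also have "\<dots> < d" using d by simp
    finally have Bd: "measure lebesgue B < d" .
    show "openin (top_of_set E) (E \<inter> B)" using B by (simp add: openin_open_Int)
    show "y \<in> E \<inter> B" using y E d by (auto simp: B_def)
    show "negligible (E \<inter> B)"
      unfolding negligible_outer
    proof (intro allI impI)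
      fix e :: real assume e: "0 < e"
      then have e2: "0 < e / 2" by simp
      \<comment> \<open>Slope \<open>2 / e\<close> forces total length below \<open>e / 2\<close>;
        the other half of \<open>e\<close> is reserved for the remainder \<open>N\<close>.\<close>
      have hiB: "\<exists>u v. u < v \<and> u \<le> x \<and> x \<le> v \<and> v - u < \<delta> \<and> 2 / e * (v - u) \<le> f v - f u"
        if "x \<in> E \<inter> B" "0 < \<delta>" for x \<delta>
        using hi[of x \<delta> "2 / e"] that by blast
      obtain P N where P: "finite P" "disjoint P"
        "\<And>K. K \<in> P \<Longrightarrow> \<exists>u v. u < v \<and> K = {u..v} \<and> {u..v} \<subseteq> B \<and> 2 / e * (v - u) \<le> f v - f u"
        and N: "N \<in> lmeasurable" "measure lebesgue N < e / 2" "E \<inter> B \<subseteq> \<Union>P \<union> N"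
        by (rule vitali_finite_cover[OF B Int_lower2 e2 hiB]) auto
      have Picc: "\<forall>K\<in>P. \<exists>u v. u < v \<and> K = {u..v}" using P(3) by blast
      note mP = measure_disjoint_Icc_Union[OF P(1,2) Picc]
      have PB: "\<Union>P \<subseteq> B" using P(3) by blast
      then have "sum (measure lborel) P \<le> measure lebesgue B"
        unfolding mP(2)[symmetric] using mP(1) mB by (intro measure_mono_fmeasurable) auto
      then have "(\<Sum>K\<in>P. \<bar>f (Sup K) - f (Inf K)\<bar>) < 1"
        using Bd PB by (intro small disjoint_Icc_division[OF P(1,2) Picc]) (auto simp: B_def)
      moreover have "2 / e * sum (measure lborel) P \<le> (\<Sum>K\<in>P. \<bar>f (Sup K) - f (Inf K)\<bar>)"
        unfolding sum_distrib_left
      proof (rule sum_mono)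
        fix K assume "K \<in> P"
        then obtain u v where "u < v" "K = {u..v}" "2 / e * (v - u) \<le> f v - f u" using P(3) by blast
        then show "2 / e * measure lborel K \<le> \<bar>f (Sup K) - f (Inf K)\<bar>" by simp
      qed
      ultimately have "2 / e * sum (measure lborel) P < 1" by simp
      then have "measure lebesgue (\<Union>P) < e / 2"
        using e by (simp add: mP(2) field_simps)
      then have "measure lebesgue (\<Union>P \<union> N) < e"
        using N mP(1) measure_Un_le[of "\<Union>P" lebesgue N] by (simp add: fmeasurableD)
      then show "\<exists>T. E \<inter> B \<subseteq> T \<and> T \<in> lmeasurable \<and> measure lebesgue T < e"
        using N mP(1) by (intro exI[of _ "\<Union>P \<union> N"]) (auto intro: fmeasurable.Un)
    qed
  qed
  then show ?thesis
    using locally_negligible_alt by blast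
qed

subsection \<open>Increments and derivatives\<close>

text \<open>The slope bound holds on some short intervals at \<open>x\<close>, not on all of them,
  so a full gauge-fine division with the bound cannot be expected, only a Vitali family. This is a
  partial division; Henstock's lemma compares its Riemann sum with the integral of \<open>h\<close>
  over its union, and \<open>h \<ge> 0\<close> extends that integral to
  \<open>{a..b}\<close>.\<close>

lemma absolutely_continuous_on_increment_le_integral:
  fixes f h :: "real \<Rightarrow> real"
  assumes ac: "absolutely_continuous_on {a..b} f" and "a \<le> b"
    and h: "h integrable_on {a..b}" and h0: "\<And>x. x \<in> {a..b} \<Longrightarrow> 0 \<le> h x" and Z: "negligible Z"
    and slope: "\<And>x \<eta> \<delta>. x \<in> {a<..<b} - Z \<Longrightarrow> 0 < \<eta> \<Longrightarrow> 0 < \<delta> \<Longrightarrow>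
      \<exists>u v. u < v \<and> u \<le> x \<and> x \<le> v \<and> v - u < \<delta> \<and> f v - f u \<le> (h x + \<eta>) * (v - u)"
  shows "f b - f a \<le> integral {a..b} h"
proof (cases "a = b")
  case False
  with \<open>a \<le> b\<close> have ab: "a < b" by simp
  \<comment> \<open>One \<open>e\<close> is the increment of \<open>f\<close> off the covered part,
    one is the slack \<eta> times the length \<open>b - a\<close>, and one is the error in
    Henstock's lemma.\<close>
  have key: "f b - f a \<le> integral {a..b} h + 3 * e" if e: "0 < e" for e
  proof -
    obtain d where d: "0 < d"
      and refine: "\<forall>P Q. finite P \<and> disjoint P \<and> (\<forall>K\<in>P. K \<subseteq> {a..b} \<and> (\<exists>u v. u \<le> v \<and> K = {u..v})) \<and>
          Q division_of \<Union>Q \<and> (\<forall>J\<in>Q. \<exists>K\<in>P. J \<subseteq> K) \<and>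
          sum (measure lborel) P - sum (measure lborel) Q < d
        \<longrightarrow> \<bar>(\<Sum>K\<in>P. f (Sup K) - f (Inf K)) - (\<Sum>K\<in>Q. f (Sup K) - f (Inf K))\<bar> < e"
      using absolutely_continuous_on_refine[OF ac e] by (elim exE conjE)
    have "(h has_integral integral (cbox a b) h) (cbox a b)"
      using h by auto
    then have "\<exists>\<gamma>. gauge \<gamma> \<and> (\<forall>p. p tagged_division_of (cbox a b) \<and> \<gamma> fine p \<longrightarrow>
        norm (sum (\<lambda>(x,K). measure lborel K *\<^sub>R h x) p - integral (cbox a b) h) < e)"
      using e unfolding has_integral by (elim allE impE)
    then obtain \<gamma> where \<gamma>: "gauge \<gamma>" and
      fine: "\<forall>p. p tagged_division_of (cbox a b) \<and> \<gamma> fine p \<longrightarrow>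
        norm (sum (\<lambda>(x,K). measure lborel K *\<^sub>R h x) p - integral (cbox a b) h) < e"
      by (elim exE conjE)
    define \<eta> where "\<eta> = e / (b - a)"
    have \<eta>: "0 < \<eta>" using e ab by (simp add: \<eta>_def)
    \<comment> \<open>The covering lemma returns intervals without the points that gave rise to
      them, so the tag is carried along as an existential inside the property.\<close>
    define good where "good u v x \<longleftrightarrow> u \<le> x \<and> x \<le> v \<and> {u..v} \<subseteq> \<gamma> x \<and> f v - f u \<le> (h x + \<eta>) * (v - u)"
      for u v x
    have bounded_ab: "bounded {a<..<b}" by simp
    have small: "\<exists>u v. u < v \<and> u \<le> x \<and> x \<le> v \<and> v - u < \<delta> \<and> (\<exists>x. good u v x)"
      if x: "x \<in> {a<..<b} - Z" and "0 < \<delta>" for x \<delta>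
    proof -
      obtain r where r: "0 < r" "ball x r \<subseteq> \<gamma> x"
        using \<gamma> by (meson gauge_def open_contains_ball)
      obtain u v where uv: "u < v" "u \<le> x" "x \<le> v" "v - u < min \<delta> r" "f v - f u \<le> (h x + \<eta>) * (v - u)"
        using slope[OF x \<eta>, of "min \<delta> r"] r \<open>0 < \<delta>\<close> by auto
      then have "{u..v} \<subseteq> ball x r" by (auto simp: dist_real_def)
      then have "good u v x" using uv r by (auto simp: good_def)
      then show ?thesis using uv by (intro exI[of _ u] exI[of _ v]) auto
    qed
    obtain P N where P: "finite P" "disjoint P"
      "\<And>K. K \<in> P \<Longrightarrow> \<exists>u v. u < v \<and> K = {u..v} \<and> {u..v} \<subseteq> {a<..<b} \<and> (\<exists>x. good u v x)"
      and N: "N \<in> lmeasurable" "measure lebesgue N < d" "{a<..<b} - Z \<subseteq> \<Union>P \<union> N"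
      by (rule vitali_finite_cover[OF open_greaterThanLessThan bounded_ab Diff_subset d small]) auto
    have Picc: "\<forall>K\<in>P. \<exists>u v. u < v \<and> K = {u..v}" using P(3) by blast
    note mP = measure_disjoint_Icc_Union[OF P(1,2) Picc]
    note divP = disjoint_Icc_division[OF P(1,2) Picc]
    have Pab: "\<Union>P \<subseteq> {a..b}" using P(3) by fastforce
    have "\<exists>x. good (Inf K) (Sup K) x" if "K \<in> P" for K
      using P(3)[OF that] by (auto simp: less_imp_le)
    then obtain t where t: "\<And>K. K \<in> P \<Longrightarrow> good (Inf K) (Sup K) (t K)" by metis
    have PK: "K = {Inf K..Sup K}" "measure lborel K = Sup K - Inf K" if "K \<in> P" for K
      using Picc that by auto
    have "measure lebesgue {a<..<b} \<le> measure lebesgue (\<Union>P \<union> N \<union> Z)"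
      using N mP(1) Z by (intro measure_mono_fmeasurable) (auto intro: fmeasurable.Un negligible_imp_measurable)
    also have "\<dots> = measure lebesgue (\<Union>P \<union> N)"
      using N mP(1) Z by (simp add: measure_Un_null_set fmeasurableD fmeasurable.Un negligible_iff_null_sets[symmetric])
    also have "\<dots> \<le> sum (measure lborel) P + measure lebesgue N"
      using N mP measure_Un_le[of "\<Union>P" lebesgue N] by (simp add: fmeasurableD)
    finally have len: "b - a - sum (measure lborel) P < d" using N(2) ab by simp
    \<comment> \<open>The coarse family is the single interval \<open>{a..b}\<close>, whose
      increment is \<open>f b - f a\<close>.\<close>
    have "\<bar>(\<Sum>K\<in>{{a..b}}. f (Sup K) - f (Inf K)) - (\<Sum>K\<in>P. f (Sup K) - f (Inf K))\<bar> < e"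
      using len ab Pab by (intro refine[rule_format] conjI divP) auto
    then have 1: "f b - f a \<le> (\<Sum>K\<in>P. f (Sup K) - f (Inf K)) + e"
      using ab by simp
    have "(\<Sum>K\<in>P. f (Sup K) - f (Inf K)) \<le> (\<Sum>K\<in>P. measure lborel K * h (t K) + \<eta> * measure lborel K)"
    proof (rule sum_mono)
      fix K assume K: "K \<in> P"
      have "f (Sup K) - f (Inf K) \<le> (h (t K) + \<eta>) * measure lborel K"
        using t[OF K] unfolding PK(2)[OF K] good_def by blast
      then show "f (Sup K) - f (Inf K) \<le> measure lborel K * h (t K) + \<eta> * measure lborel K"
        by (simp add: algebra_simps)
    qed
    also have "\<dots> = (\<Sum>K\<in>P. measure lborel K * h (t K)) + \<eta> * sum (measure lborel) P"
      by (simp add: sum.distrib sum_distrib_left)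
    finally have 2: "(\<Sum>K\<in>P. f (Sup K) - f (Inf K)) \<le> (\<Sum>K\<in>P. measure lborel K * h (t K)) + \<eta> * sum (measure lborel) P" .
    have "sum (measure lborel) P \<le> measure lborel (cbox a b)"
      using divP Pab by (intro subadditive_content_division) auto
    then have "\<eta> * sum (measure lborel) P \<le> \<eta> * (b - a)"
      using \<eta> ab by (intro mult_left_mono) auto
    then have 3: "\<eta> * sum (measure lborel) P \<le> e" using ab by (simp add: \<eta>_def)
    let ?p = "(\<lambda>K. (t K, K)) ` P"
    have "?p tagged_partial_division_of cbox a b"
      unfolding tagged_partial_division_of_def
    proof (intro conjI allI impI)
      show "finite ?p" using P(1) by simp
      fix x K assume "(x, K) \<in> ?p"
      then have K: "K \<in> P" "x = t K" by auto
      show "x \<in> K" using t[OF K(1)] PK(1)[OF K(1)] K(2) by (metis atLeastAtMost_iff good_def)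
      show "K \<subseteq> cbox a b" using Pab K(1) by auto
      show "\<exists>a b. K = cbox a b" using PK(1)[OF K(1)] by (metis box_real(2))
    next
      fix x1 K1 x2 K2 assume "(x1, K1) \<in> ?p \<and> (x2, K2) \<in> ?p \<and> (x1, K1) \<noteq> (x2, K2)"
      then show "interior K1 \<inter> interior K2 = {}"
        by (intro division_ofD(5)[OF divP]) auto
    qed
    moreover have "\<gamma> fine ?p"
      unfolding fine_def using t PK(1) by (auto simp: good_def)
    ultimately have "norm (sum (\<lambda>(x,K). measure lborel K *\<^sub>R h x - integral K h) ?p) \<le> e"
      using h by (intro Henstock_lemma_part1[OF _ e \<gamma> fine[rule_format, OF conjI]]) auto
    then have 4: "(\<Sum>K\<in>P. measure lborel K * h (t K)) \<le> (\<Sum>K\<in>P. integral K h) + e"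
      by (simp add: sum.reindex inj_on_def sum_subtractf)
    have hP: "h integrable_on \<Union>P"
      using integrable_on_subdivision[OF divP h Pab] .
    have "(\<Sum>K\<in>P. integral K h) = integral (\<Union>P) h"
      using integral_combine_division_topdown[OF hP divP] by simp
    also have "\<dots> \<le> integral {a..b} h"
      using hP h h0 Pab by (intro integral_subset_le) auto
    finally show ?thesis using 1 2 3 4 by linarith
  qed
  show ?thesis
  proof (rule field_le_epsilon)
    fix e :: real assume "0 < e"
    then show "f b - f a \<le> integral {a..b} h + e" using key[of "e / 3"] by simp
  qed
qed auto

section \<open>From difference quotients to slopes on short intervals\<close>

lemma frequently_at_small_interval:
  fixes x :: real
  assumes "\<exists>\<^sub>F y in at x. Q ((f y - f x) / (y - x))" and "0 < \<delta>"
  obtains u v where "u < v" "u \<le> x" "x \<le> v" "v - u < \<delta>" "Q ((f v - f u) / (v - u))"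
proof -
  have "\<exists>\<^sub>F y in at x. Q ((f y - f x) / (y - x)) \<and> dist y x < \<delta> \<and> y \<noteq> x"
    using assms(2) by (intro frequently_eventually_frequently[OF assms(1)])
      (auto simp: eventually_at intro!: exI[of _ \<delta>])
  then obtain y where y: "Q ((f y - f x) / (y - x))" "dist y x < \<delta>" "y \<noteq> x"
    by (auto dest: frequently_ex)
  have sym: "(f y - f x) / (y - x) = (f x - f y) / (x - y)"
    by (metis minus_diff_eq minus_divide_divide)
  show thesis
  proof (cases "x < y")
    case True
    then show ?thesis using y by (intro that[of x y]) (auto simp: dist_real_def)
  next
    case False
    then show ?thesis using y sym by (intro that[of y x]) (auto simp: dist_real_def)
  qed
qed

lemma frequently_slope_less:
  fixes x :: real
  assumes "\<exists>\<^sub>F y in at x. (f y - f x) / (y - x) < c" and "0 < \<delta>"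
  shows "\<exists>u v. u < v \<and> u \<le> x \<and> x \<le> v \<and> v - u < \<delta> \<and> f v - f u \<le> c * (v - u)"
proof -
  obtain u v where uv: "u < v" "u \<le> x" "x \<le> v" "v - u < \<delta>" "(f v - f u) / (v - u) < c"
    by (rule frequently_at_small_interval[of "\<lambda>r. r < c" f x, OF assms])
  then have "f v - f u \<le> c * (v - u)" by (simp add: pos_divide_less_eq)
  with uv show ?thesis by blast
qed

lemma frequently_slope_greater:
  fixes x :: real
  assumes "\<exists>\<^sub>F y in at x. c < (f y - f x) / (y - x)" and "0 < \<delta>"
  shows "\<exists>u v. u < v \<and> u \<le> x \<and> x \<le> v \<and> v - u < \<delta> \<and> c * (v - u) \<le> f v - f u"
proof -
  obtain u v where uv: "u < v" "u \<le> x" "x \<le> v" "v - u < \<delta>" "c < (f v - f u) / (v - u)"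
    by (rule frequently_at_small_interval[of "\<lambda>r. c < r" f x, OF assms])
  then have "c * (v - u) \<le> f v - f u" by (simp add: pos_less_divide_eq)
  with uv show ?thesis by blast
qed

text \<open>Off a null set the difference quotients have a limit in [-\<infinity>, \<infinity>).
  Either they are frequently below \<open>h x + \<eta>\<close>, which is all the slope condition
  asks for, or the limit is finite and the bound on \<open>deriv\<close> applies.\<close>

lemma absolutely_continuous_on_increment_le_integral_deriv:
  fixes f h :: "real \<Rightarrow> real"
  assumes ac: "absolutely_continuous_on {a..b} f" and "a \<le> b"
    and h: "h integrable_on {a..b}" and h0: "\<And>x. x \<in> {a..b} \<Longrightarrow> 0 \<le> h x"
    and N: "negligible N" and deriv: "\<And>x. x \<in> {a..b} - N \<Longrightarrow> deriv f x \<le> h x"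
  shows "f b - f a \<le> integral {a..b} h"
proof -
  define s where "s x y = (f y - f x) / (y - x)" for x y
  define E where "E p q = {x \<in> {a<..<b}. (\<exists>\<^sub>F y in at x. s x y < p) \<and> (\<exists>\<^sub>F y in at x. q < s x y)}" for p q
  \<comment> \<open>Rational thresholds detect every gap between lower and upper limit and keep the
    union countable.\<close>
  define EE where "EE = (\<Union>p\<in>\<rat>. \<Union>q\<in>{q \<in> \<rat>. p < q}. E p q)"
  define S where "S = {x \<in> {a<..<b}. \<forall>M. \<exists>\<^sub>F y in at x. M < s x y}"
  have "negligible (E p q)" if "p < q" for p q
  proof (rule negligible_oscillating_slopes[OF ac that])
    show "E p q \<subseteq> {a<..<b}" by (auto simp: E_def)
    fix x \<delta> :: real assume x: "x \<in> E p q" and "0 < \<delta>"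
    show "\<exists>u v. u < v \<and> u \<le> x \<and> x \<le> v \<and> v - u < \<delta> \<and> f v - f u \<le> p * (v - u)"
      using x \<open>0 < \<delta>\<close> by (intro frequently_slope_less) (simp_all add: E_def s_def)
    show "\<exists>u v. u < v \<and> u \<le> x \<and> x \<le> v \<and> v - u < \<delta> \<and> q * (v - u) \<le> f v - f u"
      using x \<open>0 < \<delta>\<close> by (intro frequently_slope_greater) (simp_all add: E_def s_def)
  qed
  then have "negligible (\<Union>r \<in> {(p, q). p \<in> \<rat> \<and> q \<in> \<rat> \<and> p < q}. E (fst r) (snd r))"
    using countable_subset[OF _ countable_SIGMA[OF countable_rat countable_rat],
        of "{(p, q). p \<in> \<rat> \<and> q \<in> \<rat> \<and> p < q}"]
    by (intro negligible_countable_Union countable_image) auto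
  moreover have "(\<Union>r \<in> {(p, q). p \<in> \<rat> \<and> q \<in> \<rat> \<and> p < q}. E (fst r) (snd r)) = EE"
    unfolding EE_def by fastforce
  ultimately have negE: "negligible EE" by simp
  have negS: "negligible S"
  proof (rule negligible_unbounded_slopes[OF ac])
    show "S \<subseteq> {a<..<b}" by (auto simp: S_def)
    fix x \<delta> M :: real assume x: "x \<in> S" and "0 < \<delta>"
    show "\<exists>u v. u < v \<and> u \<le> x \<and> x \<le> v \<and> v - u < \<delta> \<and> M * (v - u) \<le> f v - f u"
      using x \<open>0 < \<delta>\<close> by (intro frequently_slope_greater) (simp_all add: S_def s_def)
  qed
  let ?Z = "N \<union> EE \<union> S"
  show ?thesis
  proof (rule absolutely_continuous_on_increment_le_integral[OF ac \<open>a \<le> b\<close> h h0])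
    show "negligible ?Z" using N negE negS by (intro negligible_Un)
    fix x \<eta> \<delta> :: real assume x: "x \<in> {a<..<b} - ?Z" and "0 < \<eta>" "0 < \<delta>"
    have "\<exists>\<^sub>F y in at x. s x y < h x + \<eta>"
    proof (rule ccontr)
      assume "\<not> ?thesis"
      \<comment> \<open>Now the lower limit is above -\<infinity>. Off \<open>EE\<close> it equals
        the upper limit, and off \<open>S\<close> the latter is below \<infinity>; so
        \<open>f\<close> is differentiable at \<open>x\<close>, and its derivative is both at least
        \<open>h x + \<eta>\<close> and at most \<open>h x\<close>.\<close>
      then have ge: "\<forall>\<^sub>F y in at x. h x + \<eta> \<le> s x y"
        by (simp add: not_frequently not_less)
      let ?l = "Liminf (at x) (\<lambda>y. ereal (s x y))" and ?L = "Limsup (at x) (\<lambda>y. ereal (s x y))"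
      have "?L \<le> ?l"
      proof (rule ccontr)
        assume "\<not> ?thesis"
        then have "?l < ?L" by simp
        then obtain q where q: "?l < ereal q" "ereal q < ?L" using ereal_dense2 by blast
        obtain p where p: "?l < ereal p" "ereal p < ereal q" using ereal_dense2[OF q(1)] by blast
        obtain p' where p': "p' \<in> \<rat>" "p < p'" "p' < q" using p(2) Rats_dense_in_real by (metis less_ereal.simps(1))
        obtain q' where q': "q' \<in> \<rat>" "p' < q'" "q' < q" using p'(3) Rats_dense_in_real by metis
        have "\<exists>\<^sub>F y in at x. s x y < p'"
        proof (rule ccontr)
          assume "\<not> ?thesis"
          then have "\<forall>\<^sub>F y in at x. ereal p' \<le> ereal (s x y)" by (simp add: not_frequently not_less)
          then have "ereal p' \<le> ?l" by (rule Liminf_bounded)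
          then show False using p(1) p'(2) by (metis ereal_less_eq(3) less_le_not_le order_trans less_imp_le)
        qed
        moreover have "\<exists>\<^sub>F y in at x. q' < s x y"
        proof (rule ccontr)
          assume "\<not> ?thesis"
          then have "\<forall>\<^sub>F y in at x. ereal (s x y) \<le> ereal q'" by (simp add: not_frequently not_less)
          then have "?L \<le> ereal q'" by (rule Limsup_bounded)
          then show False using q(2) q'(3) by (metis ereal_less_eq(3) less_le_not_le order_trans less_imp_le)
        qed
        ultimately have "x \<in> E p' q'" using x by (auto simp: E_def)
        then show False using x p' q' by (auto simp: EE_def)
      qed
      moreover have "?l \<le> ?L" by (rule Liminf_le_Limsup) simp
      ultimately have lim: "((\<lambda>y. ereal (s x y)) \<longlongrightarrow> ?l) (at x)"
        by (intro Liminf_eq_Limsup) auto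
      have lge: "ereal (h x + \<eta>) \<le> ?l" using ge by (intro Liminf_bounded) simp
      obtain M where "\<not> (\<exists>\<^sub>F y in at x. M < s x y)" using x by (auto simp: S_def)
      then have "\<forall>\<^sub>F y in at x. ereal (s x y) \<le> ereal M" by (simp add: not_frequently not_less)
      then have "?L \<le> ereal M" by (rule Limsup_bounded)
      then have "?l \<le> ereal M" using \<open>?l \<le> ?L\<close> by (rule order_trans[rotated])
      then obtain l where l: "?l = ereal l" using lge by (cases ?l) auto
      then have "(s x \<longlongrightarrow> l) (at x)" using lim by simp
      then have "(f has_field_derivative l) (at x)"
        by (simp add: has_field_derivative_iff s_def[abs_def])
      then have "deriv f x = l" by (rule DERIV_imp_deriv)
      then show False using deriv[of x] x lge l \<open>0 < \<eta>\<close> by simp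
    qed
    then show "\<exists>u v. u < v \<and> u \<le> x \<and> x \<le> v \<and> v - u < \<delta> \<and> f v - f u \<le> (h x + \<eta>) * (v - u)"
      using \<open>0 < \<delta>\<close> by (intro frequently_slope_less) (simp_all add: s_def)
  qed
qed

subsection \<open>Gronwall inequality\<close>

text \<open>Only an increment inequality for \<theta> is available, so the integrating factor cannot
  be differentiated against \<theta>; it is applied one short interval at a time.\<close>

lemma gronwall_increment:
  fixes \<theta> e g :: "real \<Rightarrow> real"
  assumes "a \<le> b"
    and \<theta>0: "\<And>x. x \<in> {a..b} \<Longrightarrow> 0 \<le> \<theta> x"
    and e0: "\<And>x. x \<in> {a..b} \<Longrightarrow> 0 \<le> e x" and e: "e integrable_on {a..b}"
    and g0: "\<And>x. x \<in> {a..b} \<Longrightarrow> 0 \<le> g x" and g: "g integrable_on {a..b}"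
    and incr: "\<And>x y. a \<le> x \<Longrightarrow> x \<le> y \<Longrightarrow> y \<le> b \<Longrightarrow>
      \<theta> y - \<theta> x \<le> integral {x..y} e + \<theta> y * integral {x..y} g"
  shows "(\<lambda>s. e s * exp (integral {s..b} g)) integrable_on {a..b}"
    and "\<theta> b \<le> \<theta> a * exp (integral {a..b} g) + integral {a..b} (\<lambda>s. e s * exp (integral {s..b} g))"
proof -
  define F where "F x = integral {a..x} g" for x
  have gI: "g integrable_on {x..y}" if "a \<le> x" "y \<le> b" for x y
    using integrable_on_subinterval[OF g] that by auto
  have F: "integral {x..y} g = F y - F x" if "a \<le> x" "x \<le> y" "y \<le> b" for x y
    using Henstock_Kurzweil_Integration.integral_combine[of a x y g] that gI[of a y] by (simp add: F_def)
  have contF: "continuous_on {a..b} F"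
    unfolding F_def by (rule indefinite_integral_continuous_1[OF g])
  have monoF: "F x \<le> F y" if "a \<le> x" "x \<le> y" "y \<le> b" for x y
    using F[OF that] Henstock_Kurzweil_Integration.integral_nonneg[OF gI, of x y] g0 that by simp
  have abs_e: "e absolutely_integrable_on {a..b}"
    using e e0 by (intro nonnegative_absolutely_integrable_1) auto
  have int_mult: "(\<lambda>s. e s * \<phi> s) integrable_on {a..b}" if "continuous_on {a..b} \<phi>" for \<phi>
  proof -
    have "(\<lambda>s. \<phi> s * e s) absolutely_integrable_on {a..b}"
      using that by (intro absolutely_integrable_bounded_measurable_product_real[OF _ _ _ abs_e]
          continuous_imp_measurable_on_sets_lebesgue compact_imp_bounded[OF compact_continuous_image]) auto
    then show ?thesis
      by (simp add: absolutely_integrable_on_def mult.commute)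
  qed
  have intE: "(\<lambda>s. e s * exp (- c * F s)) integrable_on {a..b}" for c
    using contF by (intro int_mult continuous_intros)
  \<comment> \<open>Splitting off \<open>exp (F b)\<close> leaves a weight that does not depend on
    the right endpoint, as additivity over adjacent intervals requires.\<close>
  have exp_eq: "e s * exp (integral {s..b} g) = exp (F b) * (e s * exp (- 1 * F s))" if "s \<in> {a..b}" for s
    using that by (simp add: F exp_diff exp_minus field_simps)
  show "(\<lambda>s. e s * exp (integral {s..b} g)) integrable_on {a..b}"
    using integrable_on_mult_right[OF intE[of 1], of "exp (F b)"] exp_eq
    by (subst integrable_cong[OF exp_eq]) auto
  define J where "J = integral {a..b} (\<lambda>s. e s * exp (- 1 * F s))"
  have int_eq: "integral {a..b} (\<lambda>s. e s * exp (integral {s..b} g)) = exp (F b) * J"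
    unfolding J_def by (subst integral_mult_right[symmetric]) (rule integral_cong[OF exp_eq])
  text \<open>With \<open>c = 1 + \<delta>\<close> one has \<open>exp (- c * D) \<le> 1 - D\<close> for small increments \<open>D\<close> of \<open>F\<close>, so the claim
    holds on short intervals; in terms of \<open>\<psi>\<close> it is additive over adjacent intervals.\<close>
  have bound: "exp (- (1 + \<delta>) * F b) * \<theta> b \<le> \<theta> a + exp \<delta> * J" if \<delta>: "0 < \<delta>" for \<delta>
  proof -
    define c where "c = 1 + \<delta>"
    have c: "0 < c" using \<delta> by (simp add: c_def)
    define \<psi> where "\<psi> x = exp (- c * F x) * \<theta> x" for x
    let ?k = "\<lambda>s. e s * exp (- c * F s)"
    have kI: "?k integrable_on {x..y}" if "a \<le> x" "y \<le> b" for x y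
      using integrable_on_subinterval[OF intE[of c]] that by auto
    \<comment> \<open>Bolzano's bisection principle combines short intervals around each point into
      the whole; its predicate ranges over arbitrary endpoints, hence the guard.\<close>
    have "a \<le> a \<and> b \<le> b \<longrightarrow> \<psi> b \<le> \<psi> a + exp \<delta> * integral {a..b} ?k"
    proof (rule Bolzano[OF \<open>a \<le> b\<close>, of "\<lambda>x y. a \<le> x \<and> y \<le> b \<longrightarrow> \<psi> y \<le> \<psi> x + exp \<delta> * integral {x..y} ?k"])
      fix x y z
      assume 1: "a \<le> x \<and> y \<le> b \<longrightarrow> \<psi> y \<le> \<psi> x + exp \<delta> * integral {x..y} ?k"
        and 2: "a \<le> y \<and> z \<le> b \<longrightarrow> \<psi> z \<le> \<psi> y + exp \<delta> * integral {y..z} ?k"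
        and "x \<le> y" "y \<le> z"
      show "a \<le> x \<and> z \<le> b \<longrightarrow> \<psi> z \<le> \<psi> x + exp \<delta> * integral {x..z} ?k"
      proof
        assume xz: "a \<le> x \<and> z \<le> b"
        have "integral {x..z} ?k = integral {x..y} ?k + integral {y..z} ?k"
          using Henstock_Kurzweil_Integration.integral_combine[OF \<open>x \<le> y\<close> \<open>y \<le> z\<close> kI] xz by simp
        then show "\<psi> z \<le> \<psi> x + exp \<delta> * integral {x..z} ?k"
          using 1 2 xz \<open>x \<le> y\<close> \<open>y \<le> z\<close> by (simp add: distrib_left)
      qed
    next
      fix w assume "a \<le> w" "w \<le> b"
      \<comment> \<open>If both endpoints keep \<open>F\<close> within \<delta> / (2 * c) of
        \<open>F w\<close>, then c * D < \<delta>.\<close>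
      then obtain d where d: "0 < d" and dw: "\<And>x. x \<in> {a..b} \<Longrightarrow> dist x w < d \<Longrightarrow> dist (F x) (F w) < \<delta> / (2 * c)"
        using contF \<delta> c unfolding continuous_on_iff by (metis atLeastAtMost_iff divide_pos_pos mult_pos_pos zero_less_numeral)
      show "\<exists>d>0. \<forall>x y. x \<le> w \<and> w \<le> y \<and> y - x < d \<longrightarrow>
          a \<le> x \<and> y \<le> b \<longrightarrow> \<psi> y \<le> \<psi> x + exp \<delta> * integral {x..y} ?k"
      proof (intro exI[of _ d] conjI d allI impI)
        fix x y assume w: "x \<le> w \<and> w \<le> y \<and> y - x < d" and xy: "a \<le> x \<and> y \<le> b"
        define D where "D = F y - F x"
        have "dist (F x) (F w) < \<delta> / (2 * c)" "dist (F y) (F w) < \<delta> / (2 * c)"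
          using dw[of x] dw[of y] w xy by (simp_all add: dist_real_def abs_less_iff)
        then have "D < \<delta> / (2 * c) + \<delta> / (2 * c)" by (simp add: D_def dist_real_def)
        then have cD: "c * D < \<delta>" using c by (simp add: field_simps)
        have D0: "0 \<le> D" using monoF[of x y] w xy by (simp add: D_def)
        have \<theta>y: "0 \<le> \<theta> y" using w xy by (intro \<theta>0) auto
        \<comment> \<open>With c = 1 + \<delta> the product equals 1 + D * (\<delta> - c * D): the
          surplus \<delta> absorbs the quadratic term.\<close>
        have "1 \<le> (1 - D) * (1 + c * D)"
        proof -
          have "0 \<le> D * (\<delta> - c * D)" using D0 cD by (intro mult_nonneg_nonneg) auto
          then show ?thesis by (simp add: c_def algebra_simps)
        qed
        also have "\<dots> \<le> (1 - D) * exp (c * D)"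
        proof (rule mult_left_mono)
          show "1 + c * D \<le> exp (c * D)" by (rule exp_ge_add_one_self)
          have "D \<le> c * D" using D0 \<delta> by (simp add: c_def algebra_simps)
          moreover have "0 < 1 + c * D" using c D0 by (simp add: add_pos_nonneg)
          ultimately show "0 \<le> 1 - D"
            using \<open>1 \<le> (1 - D) * (1 + c * D)\<close> by (smt (verit) mult_neg_pos)
        qed
        finally have "exp (- c * D) \<le> 1 - D"
          by (simp add: exp_minus divide_simps field_simps)
        then have "exp (- c * D) * \<theta> y \<le> (1 - D) * \<theta> y" using \<theta>y by (rule mult_right_mono)
        also have "\<dots> \<le> \<theta> x + integral {x..y} e"
          using incr[of x y] w xy F[of x y] by (simp add: D_def algebra_simps)
        finally have "exp (- c * F x) * (exp (- c * D) * \<theta> y) \<le> exp (- c * F x) * (\<theta> x + integral {x..y} e)"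
          by (intro mult_left_mono) auto
        moreover have "exp (- c * F x) * (exp (- c * D) * \<theta> y) = \<psi> y"
        proof -
          have "exp (- c * F x) * exp (- c * D) = exp (- c * F y)"
            by (simp only: exp_add[symmetric]) (simp add: D_def algebra_simps)
          then show ?thesis by (simp only: \<psi>_def mult.assoc[symmetric])
        qed
        ultimately have "\<psi> y \<le> exp (- c * F x) * (\<theta> x + integral {x..y} e)" by (simp only:)
        also have "\<dots> = \<psi> x + exp (- c * F x) * integral {x..y} e"
          by (simp add: \<psi>_def distrib_left)
        also have "exp (- c * F x) * integral {x..y} e = integral {x..y} (\<lambda>s. exp (- c * F x) * e s)"
          by simp
        \<comment> \<open>Moving the weight from the left endpoint \<open>x\<close> to the variable
          \<open>s\<close> costs at most exp (c * D) < exp \<delta>; this is the origin of that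
          factor in the claim.\<close>
        also have "\<dots> \<le> integral {x..y} (\<lambda>s. exp \<delta> * ?k s)"
        proof (rule integral_le)
          show "(\<lambda>s. exp (- c * F x) * e s) integrable_on {x..y}"
            using integrable_on_subinterval[OF e, of x y] xy by (intro integrable_on_mult_right) auto
          show "(\<lambda>s. exp \<delta> * ?k s) integrable_on {x..y}"
            using kI xy by (intro integrable_on_mult_right) auto
          fix s assume s: "s \<in> {x..y}"
          have "F s - F x \<le> D" using monoF[of s y] s xy by (simp add: D_def)
          then have "c * (F s - F x) \<le> c * D" using c by (intro mult_left_mono) auto
          then have "- c * F x \<le> \<delta> + - c * F s" using cD by (simp add: algebra_simps)
          then have "exp (- c * F x) \<le> exp \<delta> * exp (- c * F s)"
            by (simp only: exp_add[symmetric] exp_le_cancel_iff)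
          then show "exp (- c * F x) * e s \<le> exp \<delta> * ?k s"
            using mult_right_mono[of "exp (- c * F x)" "exp \<delta> * exp (- c * F s)" "e s"] e0[of s] s xy
            by (simp add: mult_ac)
        qed
        also have "\<dots> = exp \<delta> * integral {x..y} ?k" by simp
        finally show "\<psi> y \<le> \<psi> x + exp \<delta> * integral {x..y} ?k" by simp
      qed
    qed
    then have "\<psi> b \<le> \<psi> a + exp \<delta> * integral {a..b} ?k" by simp
    moreover have "\<psi> a = \<theta> a" by (simp add: \<psi>_def F_def)
    moreover have "integral {a..b} ?k \<le> J"
      unfolding J_def
    proof (rule integral_le[OF intE intE])
      fix s assume s: "s \<in> {a..b}"
      have "0 \<le> F s" using monoF[of a s] s by (simp add: F_def)
      then have "- c * F s \<le> - 1 * F s" using \<delta> by (simp add: c_def algebra_simps)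
      then show "?k s \<le> e s * exp (- 1 * F s)" using e0[OF s] by (intro mult_left_mono) auto
    qed
    then have "exp \<delta> * integral {a..b} ?k \<le> exp \<delta> * J" by (intro mult_left_mono) auto
    ultimately have "\<psi> b \<le> \<theta> a + exp \<delta> * J" by linarith
    then show ?thesis unfolding \<psi>_def c_def .
  qed
  \<comment> \<open>The limit \<delta> \<rightarrow> 0, with \<open>1 + 0\<close> and
    \<open>exp 0\<close> left unsimplified to match the limits of the two sides.\<close>
  have "exp (- (1 + 0) * F b) * \<theta> b \<le> \<theta> a + exp 0 * J"
  proof (rule tendsto_le[of "at_right (0::real)"])
    show "((\<lambda>\<delta>. \<theta> a + exp \<delta> * J) \<longlongrightarrow> \<theta> a + exp 0 * J) (at_right 0)"
      by (intro tendsto_intros)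
    show "((\<lambda>\<delta>. exp (- (1 + \<delta>) * F b) * \<theta> b) \<longlongrightarrow> exp (- (1 + 0) * F b) * \<theta> b) (at_right 0)"
      by (intro tendsto_intros)
    show "\<forall>\<^sub>F \<delta> in at_right 0. exp (- (1 + \<delta>) * F b) * \<theta> b \<le> \<theta> a + exp \<delta> * J"
      using bound by (auto simp: eventually_at_right_field intro: exI[of _ 1])
  qed simp
  then have "exp (F b) * (exp (- F b) * \<theta> b) \<le> exp (F b) * (\<theta> a + J)"
    by (intro mult_left_mono) auto
  then show "\<theta> b \<le> \<theta> a * exp (integral {a..b} g) + integral {a..b} (\<lambda>s. e s * exp (integral {s..b} g))"
    unfolding int_eq F_def[symmetric] by (simp add: exp_minus algebra_simps)
qed

text \<open>Only this half of \<open>nn_integral_cmult\<close> survives without measurability of \<open>f\<close>; the sections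
  \<open>K\<^sub>3 t\<close> are measurable for almost every \<open>t\<close> only.\<close>

lemma nn_integral_cmult_le:
  assumes "0 \<le> r"
  shows "(\<integral>\<^sup>+x. ennreal r * f x \<partial>M) \<le> ennreal r * (\<integral>\<^sup>+x. f x \<partial>M)"
proof (cases "r = 0")
  case False
  with assms have r: "ennreal r \<noteq> 0" "ennreal r \<noteq> top" by auto
  show ?thesis
    unfolding nn_integral_def[of M "\<lambda>x. ennreal r * f x"]
  proof (rule SUP_least)
    fix \<phi> assume "\<phi> \<in> {g. simple_function M g \<and> g \<le> (\<lambda>x. ennreal r * f x)}"
    then have \<phi>: "simple_function M \<phi>" "\<And>x. \<phi> x \<le> ennreal r * f x" by (auto simp: le_fun_def)
    \<comment> \<open>Dividing by \<open>r\<close> moves a simple function below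
      \<open>r * f\<close> to one below \<open>f\<close>, and for simple functions the factor can be
      pulled out exactly.\<close>
    have "\<phi> x / ennreal r \<le> f x" for x
      using divide_right_mono_ennreal[OF \<phi>(2)[of x], of "ennreal r"] r
      by (metis ennreal_mult_divide_eq mult.commute)
    then have "(\<integral>\<^sup>+x. \<phi> x / ennreal r \<partial>M) \<le> (\<integral>\<^sup>+x. f x \<partial>M)" by (intro nn_integral_mono)
    moreover have "ennreal r * (\<phi> x / ennreal r) = \<phi> x" for x
      using r by (metis ennreal_mult_divide_eq ennreal_times_divide mult.commute)
    then have "integral\<^sup>S M \<phi> = (\<integral>\<^sup>+x. ennreal r * (\<phi> x / ennreal r) \<partial>M)"
      using nn_integral_eq_simple_integral[OF \<phi>(1)] by simp
    moreover have "\<dots> = ennreal r * (\<integral>\<^sup>+x. \<phi> x / ennreal r \<partial>M)"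
      using borel_measurable_simple_function[OF \<phi>(1)]
      by (intro nn_integral_cmult borel_measurable_divide_ennreal borel_measurable_const)
    ultimately show "integral\<^sup>S M \<phi> \<le> ennreal r * (\<integral>\<^sup>+x. f x \<partial>M)"
      by (simp add: mult_left_mono)
  qed
qed simp

section \<open>Nonnegative Lebesgue integrals as gauge integrals\<close>

lemma set_nn_integral_lebesgue_eq_integral:
  fixes f :: "real \<Rightarrow> real"
  assumes "\<And>x. x \<in> S \<Longrightarrow> 0 \<le> f x" and "f integrable_on S"
  shows "(\<integral>\<^sup>+x\<in>S. ennreal (f x) \<partial>lebesgue) = ennreal (integral S f)"
  using nn_integral_has_integral_lebesgue'[OF assms(1) integrable_integral[OF assms(2)]]
  by (simp add: nn_integral_completion)

lemma set_nn_integral_lebesgue_finite_imp_integrable_on: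
  fixes f :: "real \<Rightarrow> real"
  assumes S: "S \<in> sets lebesgue" and meas: "f \<in> borel_measurable (lebesgue_on S)"
    and nonneg: "\<And>x. x \<in> S \<Longrightarrow> 0 \<le> f x" and fin: "(\<integral>\<^sup>+x\<in>S. ennreal (f x) \<partial>lebesgue) < \<infinity>"
  shows "f integrable_on S"
proof -
  let ?h = "\<lambda>x. if x \<in> S then f x else 0"
  have "?h \<in> borel_measurable lebesgue"
    using meas S by (simp add: borel_measurable_if)
  moreover have eq: "(\<integral>\<^sup>+x. ennreal (?h x) \<partial>lebesgue) = (\<integral>\<^sup>+x\<in>S. ennreal (f x) \<partial>lebesgue)"
    by (intro nn_integral_cong) (auto simp: indicator_def)
  ultimately have "(?h has_integral enn2real (\<integral>\<^sup>+x. ennreal (?h x) \<partial>lebesgue)) UNIV"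
    using nonneg fin by (subst has_integral_iff_nn_integral_lebesgue) (auto simp: less_top)
  then show ?thesis
    unfolding has_integral_restrict_UNIV by (rule has_integral_integrable)
qed

text \<open>The differential inequality is read in \<open>ereal\<close> because a derivative may be
  negative while the right-hand side may be infinite; the conclusion is read in
  \<open>ennreal\<close> because \<epsilon> need not be integrable.\<close>

theorem theorem3p1:
  fixes T\<^sub>0 T :: real
    and \<rho> K\<^sub>1 K\<^sub>2 \<epsilon> :: "real \<Rightarrow> real"
    and K\<^sub>3 :: "real \<Rightarrow> real \<Rightarrow> real"
  assumes "T\<^sub>0 < T"
    and "absolutely_continuous_on {T\<^sub>0..T} \<rho>"
    and "\<And>t. t \<in> {T\<^sub>0..T} \<Longrightarrow> 0 \<le> \<rho> t"
    and "\<And>t. t \<in> {T\<^sub>0..T} \<Longrightarrow> 0 \<le> K\<^sub>1 t"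
    and "\<And>t. t \<in> {T\<^sub>0..T} \<Longrightarrow> 0 \<le> K\<^sub>2 t"
    and "\<And>t. t \<in> {T\<^sub>0..T} \<Longrightarrow> 0 \<le> \<epsilon> t"
    and "\<And>t s. t \<in> {T\<^sub>0..T} \<Longrightarrow> s \<in> {T\<^sub>0..T} \<Longrightarrow> 0 \<le> K\<^sub>3 t s"
    and "K\<^sub>1 \<in> borel_measurable (lebesgue_on {T\<^sub>0..T})"
    and "K\<^sub>2 \<in> borel_measurable (lebesgue_on {T\<^sub>0..T})"
    and "\<epsilon> \<in> borel_measurable (lebesgue_on {T\<^sub>0..T})"
    and "(\<lambda>(t, s). K\<^sub>3 t s) \<in> borel_measurable (lebesgue_on ({T\<^sub>0..T} \<times> {T\<^sub>0..T}))"
    and "integrable (lebesgue_on {T\<^sub>0..T}) K\<^sub>1"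
    and "(\<lambda>t. ennreal (K\<^sub>2 t) * (\<integral>\<^sup>+s\<in>{T\<^sub>0..t}. ennreal (K\<^sub>3 t s) \<partial>lebesgue))
           \<in> borel_measurable (lebesgue_on {T\<^sub>0..T})"
    and "(\<integral>\<^sup>+t\<in>{T\<^sub>0..T}. ennreal (K\<^sub>2 t) * (\<integral>\<^sup>+s\<in>{T\<^sub>0..t}. ennreal (K\<^sub>3 t s) \<partial>lebesgue) \<partial>lebesgue) < \<infinity>"
    and "AE t in lebesgue_on {T\<^sub>0..T}.
           ereal (deriv \<rho> t) \<le>
             enn2ereal (ennreal (\<epsilon> t) + ennreal (K\<^sub>1 t) * ennreal (\<rho> t)
               + ennreal (K\<^sub>2 t) * (\<integral>\<^sup>+s\<in>{T\<^sub>0..t}. ennreal (K\<^sub>3 t s) * ennreal (\<rho> s) \<partial>lebesgue))"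
  shows "\<forall>t\<in>{T\<^sub>0..T}.
           ennreal (\<rho> t) \<le>
             ennreal (\<rho> T\<^sub>0 * exp_integral (gronwall_gamma T\<^sub>0 K\<^sub>1 K\<^sub>2 K\<^sub>3) T\<^sub>0 t)
             + (\<integral>\<^sup>+s\<in>{T\<^sub>0..t}. ennreal (\<epsilon> s * exp_integral (gronwall_gamma T\<^sub>0 K\<^sub>1 K\<^sub>2 K\<^sub>3) s t) \<partial>lebesgue)"
proof
  fix t assume t: "t \<in> {T\<^sub>0..T}"
  let ?I = "{T\<^sub>0..T}"
  define \<Gamma> where "\<Gamma> = gronwall_gamma T\<^sub>0 K\<^sub>1 K\<^sub>2 K\<^sub>3"
  define k where "k t = ennreal (K\<^sub>2 t) * (\<integral>\<^sup>+s\<in>{T\<^sub>0..t}. ennreal (K\<^sub>3 t s) \<partial>lebesgue)" for t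
  \<comment> \<open>A real-valued version of \<gamma>, set to 0 where \<gamma> is infinite. Since
    \<gamma> has finite integral this happens on a null set only, so the exponentials are
    unchanged.\<close>
  define g where "g t = enn2real (\<Gamma> t)" for t
  have \<Gamma>: "\<Gamma> t = ennreal (K\<^sub>1 t) + k t" for t
    by (simp add: \<Gamma>_def gronwall_gamma_def k_def)
  have k_meas[measurable]: "k \<in> borel_measurable (lebesgue_on ?I)"
    using assms(13) unfolding k_def[abs_def] .
  note assms(8)[measurable]
  have \<Gamma>_meas[measurable]: "\<Gamma> \<in> borel_measurable (lebesgue_on ?I)"
    unfolding \<Gamma>[abs_def] by measurable
  have restr: "(\<integral>\<^sup>+x\<in>?I. f x \<partial>lebesgue) = (\<integral>\<^sup>+x. f x \<partial>lebesgue_on ?I)" for f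
    by (simp add: nn_integral_restrict_space)
  have "(\<integral>\<^sup>+x. ennreal (K\<^sub>1 x) \<partial>lebesgue_on ?I) = (\<integral>\<^sup>+x. ennreal (norm (K\<^sub>1 x)) \<partial>lebesgue_on ?I)"
    using assms(4) by (intro nn_integral_cong) (auto simp: space_restrict_space)
  also have "\<dots> < \<infinity>"
    using assms(12) by (simp add: integrable_iff_bounded)
  finally have \<Gamma>_fin: "(\<integral>\<^sup>+x. \<Gamma> x \<partial>lebesgue_on ?I) < \<infinity>"
    using assms(14) unfolding restr k_def[symmetric] \<Gamma>
    by (subst nn_integral_add) (auto simp: less_top)
  then have "AE x in lebesgue_on ?I. \<Gamma> x \<noteq> \<infinity>"
    by (intro nn_integral_PInf_AE) auto
  then have \<Gamma>_AE: "AE x in lebesgue. x \<in> ?I \<longrightarrow> \<Gamma> x \<noteq> \<infinity>"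
    by (simp add: AE_restrict_space_iff)
  have g0: "0 \<le> g x" for x by (simp add: g_def)
  have g_le: "ennreal (g x) \<le> \<Gamma> x" for x
    unfolding g_def by (cases "\<Gamma> x") auto
  have g_eq: "ennreal (g x) = \<Gamma> x" if "\<Gamma> x \<noteq> \<infinity>" for x
    using that unfolding g_def by (simp add: less_top)
  have g_int: "g integrable_on ?I"
  proof (rule set_nn_integral_lebesgue_finite_imp_integrable_on)
    show "g \<in> borel_measurable (lebesgue_on ?I)" unfolding g_def[abs_def] by measurable
    have "(\<integral>\<^sup>+x. ennreal (g x) \<partial>lebesgue_on ?I) \<le> (\<integral>\<^sup>+x. \<Gamma> x \<partial>lebesgue_on ?I)"
      using g_le by (intro nn_integral_mono)
    then show "(\<integral>\<^sup>+x\<in>?I. ennreal (g x) \<partial>lebesgue) < \<infinity>"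
      unfolding restr using \<Gamma>_fin by (rule le_less_trans)
  qed (use g0 in auto)
  have g_sub: "g integrable_on {x..y}" if "T\<^sub>0 \<le> x" "y \<le> T" for x y
    using integrable_on_subinterval[OF g_int] that by auto
  have exp_g: "exp_integral \<Gamma> x y = exp (integral {x..y} g)" if "T\<^sub>0 \<le> x" "y \<le> T" for x y
  proof -
    have "(\<integral>\<^sup>+s\<in>{x..y}. \<Gamma> s \<partial>lebesgue) = (\<integral>\<^sup>+s\<in>{x..y}. ennreal (g s) \<partial>lebesgue)"
      using \<Gamma>_AE that by (intro nn_integral_cong_AE) (auto elim!: eventually_mono simp: g_eq indicator_def)
    also have "\<dots> = ennreal (integral {x..y} g)"
      using g0 g_sub that by (intro set_nn_integral_lebesgue_eq_integral) auto
    finally show ?thesis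
      using Henstock_Kurzweil_Integration.integral_nonneg[OF g_sub[OF that]] g0 by (simp add: exp_integral_def)
  qed
  have "ennreal (\<rho> t) \<le> ennreal (\<rho> T\<^sub>0 * exp_integral \<Gamma> T\<^sub>0 t)
    + (\<integral>\<^sup>+s\<in>{T\<^sub>0..t}. ennreal (\<epsilon> s * exp_integral \<Gamma> s t) \<partial>lebesgue)"
  proof (cases "(\<integral>\<^sup>+s\<in>{T\<^sub>0..t}. ennreal (\<epsilon> s) \<partial>lebesgue) = \<infinity>")
    case True
    \<comment> \<open>The exponential weight is at least 1, so the right-hand side of the claim is
      infinite too.\<close>
    have "(\<integral>\<^sup>+s\<in>{T\<^sub>0..t}. ennreal (\<epsilon> s) \<partial>lebesgue)
        \<le> (\<integral>\<^sup>+s\<in>{T\<^sub>0..t}. ennreal (\<epsilon> s * exp_integral \<Gamma> s t) \<partial>lebesgue)"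
    proof (intro nn_integral_mono)
      fix s
      show "ennreal (\<epsilon> s) * indicator {T\<^sub>0..t} s \<le> ennreal (\<epsilon> s * exp_integral \<Gamma> s t) * indicator {T\<^sub>0..t} s"
      proof (cases "s \<in> {T\<^sub>0..t}")
        case True
        then have "0 \<le> \<epsilon> s" using assms(6) t by simp
        moreover have "1 \<le> exp_integral \<Gamma> s t" by (simp add: exp_integral_def)
        ultimately have "\<epsilon> s * 1 \<le> \<epsilon> s * exp_integral \<Gamma> s t" by (intro mult_left_mono)
        then show ?thesis using True by (simp add: ennreal_leI)
      qed simp
    qed
    then show ?thesis using True by (simp add: top_unique)
  next
    case False
    have \<epsilon>0: "0 \<le> \<epsilon> x" if "x \<in> {T\<^sub>0..t}" for x using assms(6) that t by auto
    have \<epsilon>_int: "\<epsilon> integrable_on {T\<^sub>0..t}"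
    proof (rule set_nn_integral_lebesgue_finite_imp_integrable_on)
      show "\<epsilon> \<in> borel_measurable (lebesgue_on {T\<^sub>0..t})"
        using t by (intro measurable_restrict_mono[OF assms(10)]) auto
    qed (use False \<epsilon>0 in \<open>auto simp: less_top\<close>)
    define \<theta> where "\<theta> x = (SUP u\<in>{T\<^sub>0..x}. \<rho> u)" for x
    have "bdd_above (\<rho> ` ?I)"
      by (intro bounded_imp_bdd_above compact_imp_bounded compact_continuous_image compact_Icc
          absolutely_continuous_on_imp_continuous_on assms(2))
    then have bdd: "bdd_above (\<rho> ` {T\<^sub>0..x})" if "x \<le> T" for x
      using that by (auto intro: bdd_above_mono[OF _ image_mono])
    have \<rho>_le: "\<rho> u \<le> \<theta> x" if "T\<^sub>0 \<le> u" "u \<le> x" "x \<le> T" for u x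
      unfolding \<theta>_def using that by (intro cSUP_upper bdd) auto
    have \<theta>0: "0 \<le> \<theta> x" if "T\<^sub>0 \<le> x" "x \<le> T" for x
      using \<rho>_le[of x x] assms(3)[of x] that by simp
    obtain N where N: "negligible N"
      and N_fin: "\<And>s. s \<in> ?I - N \<Longrightarrow> \<Gamma> s \<noteq> \<infinity>"
      and N_le: "\<And>s. s \<in> ?I - N \<Longrightarrow> ereal (deriv \<rho> s) \<le>
             enn2ereal (ennreal (\<epsilon> s) + ennreal (K\<^sub>1 s) * ennreal (\<rho> s)
               + ennreal (K\<^sub>2 s) * (\<integral>\<^sup>+r\<in>{T\<^sub>0..s}. ennreal (K\<^sub>3 s r) * ennreal (\<rho> r) \<partial>lebesgue))"
    proof -
      have "AE s in lebesgue. s \<in> ?I \<longrightarrow> \<Gamma> s \<noteq> \<infinity> \<and> ereal (deriv \<rho> s) \<le>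
             enn2ereal (ennreal (\<epsilon> s) + ennreal (K\<^sub>1 s) * ennreal (\<rho> s)
               + ennreal (K\<^sub>2 s) * (\<integral>\<^sup>+r\<in>{T\<^sub>0..s}. ennreal (K\<^sub>3 s r) * ennreal (\<rho> r) \<partial>lebesgue))"
        using \<Gamma>_AE assms(15) by (simp add: AE_restrict_space_iff AE_conj_iff imp_conjR)
      then obtain N where N: "N \<in> null_sets lebesgue"
        and "\<And>s. s \<in> space lebesgue - N \<Longrightarrow> s \<in> ?I \<longrightarrow> \<Gamma> s \<noteq> \<infinity> \<and> ereal (deriv \<rho> s) \<le>
             enn2ereal (ennreal (\<epsilon> s) + ennreal (K\<^sub>1 s) * ennreal (\<rho> s)
               + ennreal (K\<^sub>2 s) * (\<integral>\<^sup>+r\<in>{T\<^sub>0..s}. ennreal (K\<^sub>3 s r) * ennreal (\<rho> r) \<partial>lebesgue))"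
        by (rule AE_E3) blast
      then show thesis
        by (intro that[of N]) (simp_all add: negligible_iff_null_sets)
    qed
    \<comment> \<open>Freezing the coefficient at \<open>\<theta> y\<close> bounds \<rho> on all of
      \<open>{T\<^sub>0..y}\<close> by a constant, which leaves the memory integral. The bound does
      not depend on the intermediate point \<open>u\<close>, so a supremum over \<open>u\<close> can
      be taken.\<close>
    have incr\<rho>: "\<rho> u - \<rho> x \<le> integral {x..y} \<epsilon> + \<theta> y * integral {x..y} g"
      if xy: "T\<^sub>0 \<le> x" "x \<le> u" "u \<le> y" "y \<le> t" for x u y
    proof -
      let ?h = "\<lambda>s. \<epsilon> s + \<theta> y * g s"
      have yT: "y \<le> T" using xy t by simp
      have \<epsilon>_sub: "\<epsilon> integrable_on {x..y}"
        using integrable_on_subinterval[OF \<epsilon>_int] xy by auto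
      have g_sub': "(\<lambda>s. \<theta> y * g s) integrable_on {x..y}"
        using g_sub[OF xy(1) yT] by (rule integrable_on_mult_right)
      have h_int: "?h integrable_on {x..y}" using \<epsilon>_sub g_sub' by (rule integrable_add)
      have \<theta>y: "0 \<le> \<theta> y" using \<theta>0 xy yT by simp
      have h0: "0 \<le> ?h s" if "s \<in> {x..y}" for s
        using \<epsilon>0[of s] g0[of s] \<theta>y that xy by simp
      have h_int': "?h integrable_on {x..u}"
        using integrable_on_subinterval[OF h_int] xy by auto
      have deriv_le: "deriv \<rho> s \<le> ?h s" if s: "s \<in> {x..u} - N" for s
      proof -
        have sI: "s \<in> ?I" "s \<in> ?I - N" "s \<in> {x..y}" using s xy yT by auto
        have "(\<integral>\<^sup>+r\<in>{T\<^sub>0..s}. ennreal (K\<^sub>3 s r) * ennreal (\<rho> r) \<partial>lebesgue)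
            \<le> (\<integral>\<^sup>+r. ennreal (\<theta> y) * (ennreal (K\<^sub>3 s r) * indicator {T\<^sub>0..s} r) \<partial>lebesgue)"
        proof (rule nn_integral_mono)
          fix r
          show "ennreal (K\<^sub>3 s r) * ennreal (\<rho> r) * indicator {T\<^sub>0..s} r
              \<le> ennreal (\<theta> y) * (ennreal (K\<^sub>3 s r) * indicator {T\<^sub>0..s} r)"
          proof (cases "r \<in> {T\<^sub>0..s}")
            case True
            then have "\<rho> r \<le> \<theta> y" using s xy yT by (intro \<rho>_le) auto
            then have "ennreal (K\<^sub>3 s r) * ennreal (\<rho> r) \<le> ennreal (K\<^sub>3 s r) * ennreal (\<theta> y)"
              by (intro mult_left_mono ennreal_leI) auto
            then show ?thesis using True by (simp add: mult.commute)
          qed simp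
        qed
        also have "\<dots> \<le> ennreal (\<theta> y) * (\<integral>\<^sup>+r\<in>{T\<^sub>0..s}. ennreal (K\<^sub>3 s r) \<partial>lebesgue)"
          using \<theta>y by (rule nn_integral_cmult_le)
        finally have "ennreal (K\<^sub>2 s) * (\<integral>\<^sup>+r\<in>{T\<^sub>0..s}. ennreal (K\<^sub>3 s r) * ennreal (\<rho> r) \<partial>lebesgue)
            \<le> ennreal (K\<^sub>2 s) * (ennreal (\<theta> y) * (\<integral>\<^sup>+r\<in>{T\<^sub>0..s}. ennreal (K\<^sub>3 s r) \<partial>lebesgue))"
          by (rule mult_left_mono) simp
        also have "\<dots> = ennreal (\<theta> y) * k s" by (simp add: k_def mult.left_commute)
        finally have 1: "ennreal (K\<^sub>2 s) * (\<integral>\<^sup>+r\<in>{T\<^sub>0..s}. ennreal (K\<^sub>3 s r) * ennreal (\<rho> r) \<partial>lebesgue)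
            \<le> ennreal (\<theta> y) * k s" .
        have "\<rho> s \<le> \<theta> y" using s xy yT by (intro \<rho>_le) auto
        then have 2: "ennreal (K\<^sub>1 s) * ennreal (\<rho> s) \<le> ennreal (\<theta> y) * ennreal (K\<^sub>1 s)"
          by (subst mult.commute) (intro mult_right_mono ennreal_leI, auto)
        have "ennreal (\<epsilon> s) + ennreal (K\<^sub>1 s) * ennreal (\<rho> s)
               + ennreal (K\<^sub>2 s) * (\<integral>\<^sup>+r\<in>{T\<^sub>0..s}. ennreal (K\<^sub>3 s r) * ennreal (\<rho> r) \<partial>lebesgue)
            \<le> ennreal (\<epsilon> s) + ennreal (\<theta> y) * ennreal (K\<^sub>1 s) + ennreal (\<theta> y) * k s"
          by (intro add_mono order_refl 1 2)
        also have "\<dots> = ennreal (\<epsilon> s) + ennreal (\<theta> y) * \<Gamma> s"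
          by (simp add: \<Gamma> distrib_left add.assoc)
        also have "\<dots> = ennreal (?h s)"
          using \<epsilon>0[of s] g0[of s] \<theta>y sI(3) xy
          by (simp add: ennreal_plus ennreal_mult g_eq[OF N_fin[OF sI(2)]])
        finally have "ereal (deriv \<rho> s) \<le> enn2ereal (ennreal (?h s))"
          using N_le[OF sI(2)] by (meson less_eq_ennreal.rep_eq order_trans)
        then show ?thesis using h0[OF sI(3)] by (simp add: enn2ereal_ennreal)
      qed
      have "\<rho> u - \<rho> x \<le> integral {x..u} ?h"
      proof (rule absolutely_continuous_on_increment_le_integral_deriv[where N = N])
        show "absolutely_continuous_on {x..u} \<rho>"
          using xy yT by (intro absolutely_continuous_on_subset[OF assms(2)]) auto
        show "0 \<le> ?h s" if "s \<in> {x..u}" for s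
          using that xy by (intro h0) auto
      qed (fact xy(2) h_int' N deriv_le)+
      also have "\<dots> \<le> integral {x..y} ?h"
        using xy h0 by (intro integral_subset_le h_int h_int') auto
      also have "\<dots> = integral {x..y} \<epsilon> + \<theta> y * integral {x..y} g"
        using integral_add[OF \<epsilon>_sub g_sub'] by simp
      finally show ?thesis .
    qed
    have incr: "\<theta> y - \<theta> x \<le> integral {x..y} \<epsilon> + \<theta> y * integral {x..y} g"
      if xy: "T\<^sub>0 \<le> x" "x \<le> y" "y \<le> t" for x y
    proof -
      let ?R = "integral {x..y} \<epsilon> + \<theta> y * integral {x..y} g"
      have yT: "y \<le> T" using xy t by simp
      \<comment> \<open>The increment bound at u = x has left-hand side 0.\<close>
      have R0: "0 \<le> ?R"
        using incr\<rho>[of x x y] xy by simp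
      \<comment> \<open>Either \<open>u\<close> lies before \<open>x\<close> and \<theta> x already
        dominates \<rho> u, or \<rho> rises from \<rho> x \<le> \<theta> x by at most
        \<open>?R\<close>.\<close>
      have "\<theta> y \<le> \<theta> x + ?R"
        unfolding \<theta>_def[of y]
      proof (rule cSUP_least)
        fix u assume u: "u \<in> {T\<^sub>0..y}"
        have "\<rho> u \<le> \<theta> x + ?R"
        proof (cases "u \<le> x")
          case True
          then have "\<rho> u \<le> \<theta> x" using u xy yT by (intro \<rho>_le) auto
          then show ?thesis using R0 by simp
        next
          case False
          then show ?thesis
            using incr\<rho>[of x u y] \<rho>_le[of x x] u xy yT by simp
        qed
        then show "\<rho> u \<le> \<theta> x + (integral {x..y} \<epsilon> + (SUP u\<in>{T\<^sub>0..y}. \<rho> u) * integral {x..y} g)"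
          by (simp add: \<theta>_def)
      qed (use xy in auto)
      then show ?thesis by simp
    qed
    have tT: "T\<^sub>0 \<le> t" "t \<le> T" using t by auto
    have pre: "\<And>x. x \<in> {T\<^sub>0..t} \<Longrightarrow> 0 \<le> \<theta> x" using \<theta>0 tT by auto
    have gt: "g integrable_on {T\<^sub>0..t}" by (rule g_sub) (use tT in auto)
    note gw = gronwall_increment[OF tT(1) pre \<epsilon>0 \<epsilon>_int g0 gt incr]
    have "\<rho> t \<le> \<theta> t" using \<rho>_le tT by simp
    also have "\<dots> \<le> \<theta> T\<^sub>0 * exp (integral {T\<^sub>0..t} g) + integral {T\<^sub>0..t} (\<lambda>s. \<epsilon> s * exp (integral {s..t} g))"
      by (rule gw(2))
    also have "\<theta> T\<^sub>0 = \<rho> T\<^sub>0" by (simp add: \<theta>_def)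
    finally have "ennreal (\<rho> t) \<le> ennreal (\<rho> T\<^sub>0 * exp (integral {T\<^sub>0..t} g)
        + integral {T\<^sub>0..t} (\<lambda>s. \<epsilon> s * exp (integral {s..t} g)))"
      by (rule ennreal_leI)
    also have "\<dots> = ennreal (\<rho> T\<^sub>0 * exp (integral {T\<^sub>0..t} g))
        + ennreal (integral {T\<^sub>0..t} (\<lambda>s. \<epsilon> s * exp (integral {s..t} g)))"
      using assms(3)[of T\<^sub>0] tT \<epsilon>0 gw(1)
      by (intro ennreal_plus mult_nonneg_nonneg Henstock_Kurzweil_Integration.integral_nonneg) auto
    also have "ennreal (integral {T\<^sub>0..t} (\<lambda>s. \<epsilon> s * exp (integral {s..t} g)))
        = (\<integral>\<^sup>+s\<in>{T\<^sub>0..t}. ennreal (\<epsilon> s * exp (integral {s..t} g)) \<partial>lebesgue)"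
      using \<epsilon>0 gw(1) by (intro set_nn_integral_lebesgue_eq_integral[symmetric]) auto
    also have "\<dots> = (\<integral>\<^sup>+s\<in>{T\<^sub>0..t}. ennreal (\<epsilon> s * exp_integral \<Gamma> s t) \<partial>lebesgue)"
      using exp_g tT by (intro nn_integral_cong) (auto simp: indicator_def)
    finally show ?thesis using exp_g[of T\<^sub>0 t] tT by simp
  qed
  then show "ennreal (\<rho> t) \<le>
             ennreal (\<rho> T\<^sub>0 * exp_integral (gronwall_gamma T\<^sub>0 K\<^sub>1 K\<^sub>2 K\<^sub>3) T\<^sub>0 t)
             + (\<integral>\<^sup>+s\<in>{T\<^sub>0..t}. ennreal (\<epsilon> s * exp_integral (gronwall_gamma T\<^sub>0 K\<^sub>1 K\<^sub>2 K\<^sub>3) s t) \<partial>lebesgue)"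
    unfolding \<Gamma>_def .
qed

end
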